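(* The dimensions of the relative cochain spaces $C^{m}_{GF}(\mathfrak{ham}_4^0,Sp(4,\mathbb{R}))_2$ of weight $2$ in degrees $m=0,1,2$ are $0,0,1$ respectively. Thus the Euler characteristic number of weight $2$ is $(-1)^0\cdot 0+(-1)^1\cdot 0+(-1)^2\cdot 1=1$.
   Context: On $\mathbb{R}^4$ with coordinates $x_1,x_2,x_3,x_4$ use the Poisson bracket $\{f,g\}=\frac{\partial f}{\partial x_1}\frac{\partial g}{\partial x_4}+\frac{\partial f}{\partial x_2}\frac{\partial g}{\partial x_3}-\frac{\partial f}{\partial x_3}\frac{\partial g}{\partial x_2}-\frac{\partial f}{\partial x_4}\frac{\partial g}{\partial x_1}$. Let $\mathfrak{ham}_4^0$ be the Lie algebra of Hamiltonian vector fields with polynomial potentials vanishing at the origin, identified with the Lie algebra, under $\{\cdot,\cdot\}$, of real polynomials all of whose homogeneous components have degree $\ge 2$. Let $\mathfrak{S}_\ell$ be the dual space of the space of homogeneous polynomials of degree $\ell$. Nonzero elements of $\mathfrak{S}_\ell$ have weight $\ell-2$, and nonzero elements of $\mathfrak{S}_{\ell_1}\wedge\cdots\wedge\mathfrak{S}_{\ell_s}$ have weight $\sum_i(\ell_i-2)$. The degree $m$, weight $w$ cochain space is $$C^m_{GF}(\mathfrak{ham}_4^0)_w=\bigoplus \Lambda^{k_2}\mathfrak{S}_2\wedge\Lambda^{k_3}\mathfrak{S}_3\wedge\cdots\wedge\Lambda^{k_s}\mathfrak{S}_s,$$ the sum being over all finite sequences of non-negative integers $(k_2,k_3,\dots)$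 with $\sum_i k_i=m$ and $\sum_i k_i(i-2)=w$. The coboundary operator $d$ is the (degree $+1$) antiderivation determined on $1$-cochains by $(d z)(f,g)=-\langle z,\{f,g\}\rangle$; it preserves weight. The relative cochain space $C^m_{GF}(\mathfrak{ham}_4^0,Sp(4,\mathbb{R}))_w$ consists of those $\sigma\in C^m_{GF}(\mathfrak{ham}_4^0)_w$ with $i_{\hat J(\xi)}\sigma=0$ and $i_{\hat J(\xi)}d\sigma=0$ for all $\xi\in\mathfrak{sp}(4,\mathbb{R})$, where $J$ is the momentum mapping of the linear action of $Sp(4,\mathbb{R})$ on $\mathbb{R}^4$, so that $\hat J(\xi)$ ranges over all homogeneous quadratic polynomials, and $i$ denotes interior product. (Equivalently, it is the space of $Sp(4,\mathbb{R})$-invariant cochains in which $\mathfrak{S}_2$ does not appear.) The Euler characteristic number of weight $w$ is $\sum_m(-1)^m\dim C^m_{GF}(\mathfrak{ham}_4^0,Sp(4,\mathbb{R}))_w$. *)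

theory Defs
  imports
    "HOL-Analysis.Analysis"
    "HOL-Analysis.Finite_Function_Topology"
    "HOL-Library.Function_Algebras"
begin

section \<open>Real-valued functions as a vector space\<close>

instantiation "fun" :: (type, real_vector) real_vector
begin

definition scaleR_fun :: "real \<Rightarrow> ('a \<Rightarrow> 'b) \<Rightarrow> 'a \<Rightarrow> 'b" where
  "scaleR_fun c f = (\<lambda>x. c *\<^sub>R f x)"

instance
  by standard (auto simp: scaleR_fun_def fun_eq_iff algebra_simps)

end

lemma scaleR_fun_apply [simp]: "(c *\<^sub>R f) x = c *\<^sub>R f x"
  by (simp add: scaleR_fun_def)

lemma minus_fun_apply' [simp]: "(f - g) x = f x - g x"
  by (simp add: fun_diff_def)

lemma uminus_fun_apply' [simp]: "(- f) x = - f x"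
  by (simp add: fun_Compl_def)

lemma sum_fun_apply' [simp]: "sum f A x = (\<Sum>a\<in>A. f a x)"
  by (induction A rule: infinite_finite_induct) auto


section \<open>The Lie algebra of Hamiltonian polynomials of order at least two\<close>

text \<open>A monomial \<open>x\<^sub>1^a\<^sub>1 \<dots> x\<^sub>4^a\<^sub>4\<close> is represented by its exponent vector, a polynomial by
  its finitely supported coefficient function; \<open>4 = 0\<close> in the index type, which is harmless.\<close>

type_synonym poly4 = "(nat ^ 4) \<Rightarrow>\<^sub>0 real"

definition mdeg :: "nat ^ 4 \<Rightarrow> nat" where
  "mdeg A = (\<Sum>i\<in>UNIV. A $ i)"

definition partial :: "4 \<Rightarrow> poly4 \<Rightarrow> poly4" where
  "partial i p =
     (\<Sum>A\<in>Poly_Mapping.keys p.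
        Poly_Mapping.single (A - axis i 1) (real (A $ i) * Poly_Mapping.lookup p A))"

definition poisson :: "poly4 \<Rightarrow> poly4 \<Rightarrow> poly4" where
  "poisson f g = partial 1 f * partial 4 g + partial 2 f * partial 3 g
               - partial 3 f * partial 2 g - partial 4 f * partial 1 g"

lemma mdeg_add: "mdeg (A + B) = mdeg A + mdeg B"
  by (simp add: mdeg_def sum.distrib)

lemma mdeg_axis [simp]: "mdeg (axis i n) = n"
  by (simp add: mdeg_def axis_def)

lemma finite_mdeg_le: "finite {A. mdeg A \<le> n}"
proof (rule finite_subset)
  show "{A. mdeg A \<le> n} \<subseteq> {A. \<forall>i. A $ i \<in> {..n}}"
  proof safe
    fix A :: "nat ^ 4" and i assume "mdeg A \<le> n"
    moreover have "A $ i \<le> mdeg A"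
      unfolding mdeg_def by (rule member_le_sum) auto
    ultimately show "A $ i \<le> n" by simp
  qed
  have "{A :: nat ^ 4. \<forall>i. A $ i \<in> {..n}} \<subseteq> vec_lambda ` (UNIV \<rightarrow>\<^sub>E {..n})"
    by (auto intro!: image_eqI[where x = "($) _"])
  then show "finite {A :: nat ^ 4. \<forall>i. A $ i \<in> {..n}}"
    by (rule finite_subset) (auto intro!: finite_PiE)
qed

lemma sub_axis_eq_iff:
  fixes A B :: "nat ^ 4"
  assumes "A $ i > 0"
  shows "A - axis i 1 = B \<longleftrightarrow> A = B + axis i 1"
  using assms by (auto simp: vec_eq_iff axis_def)

lemma lookup_partial:
  "Poly_Mapping.lookup (partial i p) A = real (A $ i + 1) * Poly_Mapping.lookup p (A + axis i 1)"
proof -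
  have "Poly_Mapping.lookup (partial i p) A =
      (\<Sum>B\<in>Poly_Mapping.keys p. if B = A + axis i 1 then real (B $ i) * Poly_Mapping.lookup p B else 0)"
    unfolding partial_def lookup_sum
  proof (rule sum.cong)
    fix B
    show "Poly_Mapping.lookup (Poly_Mapping.single (B - axis i 1) (real (B $ i) * Poly_Mapping.lookup p B)) A =
      (if B = A + axis i 1 then real (B $ i) * Poly_Mapping.lookup p B else 0)"
    proof (cases "B $ i = 0")
      case True
      then have "B \<noteq> A + axis i 1" by (auto simp: axis_def)
      with True show ?thesis by simp
    next
      case False
      then show ?thesis
        using sub_axis_eq_iff[of B i A] by (auto simp: lookup_single when_def)
    qed
  qed simp
  also have "\<dots> = real (A $ i + 1) * Poly_Mapping.lookup p (A + axis i 1)"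
    by (auto simp: sum.delta in_keys_iff axis_def)
  finally show ?thesis .
qed

lemma partial_add: "partial i (p + q) = partial i p + partial i q"
  by (rule poly_mapping_eqI) (simp add: lookup_partial lookup_add algebra_simps)

lemma lookup_scaleR': "Poly_Mapping.lookup (c *\<^sub>R (p :: poly4)) A = c * Poly_Mapping.lookup p A"
  by (simp add: scaleR_poly_mapping_def eq_onp_def)

lemma partial_scaleR: "partial i (c *\<^sub>R p) = c *\<^sub>R partial i p"
  by (rule poly_mapping_eqI) (simp add: lookup_partial lookup_scaleR')

lemma scaleR_conv_times: "c *\<^sub>R (p :: poly4) = Poly_Mapping.single 0 c * p"
proof -
  have "c *\<^sub>R p = Poly_Mapping.map ((*) c) p"
    by (rule poly_mapping_eqI) (simp add: lookup_scaleR' map.rep_eq when_def)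
  then show ?thesis by (simp add: mult_map_scale_conv_mult)
qed

lemma poisson_add_left: "poisson (p + q) r = poisson p r + poisson q r"
  by (simp add: poisson_def partial_add algebra_simps)

lemma poisson_scaleR_left: "poisson (c *\<^sub>R p) r = c *\<^sub>R poisson p r"
  unfolding poisson_def partial_scaleR
  unfolding scaleR_conv_times
  by (simp only: mult.assoc mult.left_commute right_diff_distrib distrib_left)

lemma poisson_skew: "poisson p q = - poisson q p"
  by (simp add: poisson_def algebra_simps)

lemma keys_partial_times:
  assumes "C \<in> Poly_Mapping.keys (partial i p * partial j q)"
  obtains A B where "A \<in> Poly_Mapping.keys p" "B \<in> Poly_Mapping.keys q" "mdeg C + 2 = mdeg A + mdeg B"
proof -
  from assms Poly_Mapping.keys_mult[of "partial i p" "partial j q"]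
  obtain A B where AB: "A \<in> Poly_Mapping.keys (partial i p)" "B \<in> Poly_Mapping.keys (partial j q)" "C = A + B"
    by auto
  show ?thesis
  proof
    show "A + axis i 1 \<in> Poly_Mapping.keys p" "B + axis j 1 \<in> Poly_Mapping.keys q"
      using AB by (auto simp: in_keys_iff lookup_partial)
    show "mdeg C + 2 = mdeg (A + axis i 1) + mdeg (B + axis j 1)"
      using AB by (simp add: mdeg_add)
  qed
qed

lemma keys_minus_subset: "Poly_Mapping.keys (p - q :: poly4) \<subseteq> Poly_Mapping.keys p \<union> Poly_Mapping.keys q"
  by (auto simp: in_keys_iff lookup_minus)

lemma keys_poisson:
  assumes "C \<in> Poly_Mapping.keys (poisson p q)"
  obtains A B where "A \<in> Poly_Mapping.keys p" "B \<in> Poly_Mapping.keys q" "mdeg C + 2 = mdeg A + mdeg B"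
proof -
  have "C \<in> Poly_Mapping.keys (partial 1 p * partial 4 q) \<union> Poly_Mapping.keys (partial 2 p * partial 3 q)
      \<union> Poly_Mapping.keys (partial 3 p * partial 2 q) \<union> Poly_Mapping.keys (partial 4 p * partial 1 q)"
    using assms unfolding poisson_def
    by (auto dest!: subsetD[OF keys_minus_subset] subsetD[OF keys_add])
  then show ?thesis by (elim UnE) (erule keys_partial_times, rule that, assumption+)+
qed

typedef ham4 = "{p :: poly4. \<forall>A\<in>Poly_Mapping.keys p. 2 \<le> mdeg A}"
  by (rule exI[of _ 0]) simp

setup_lifting type_definition_ham4

instantiation ham4 :: real_vector
begin

lift_definition zero_ham4 :: ham4 is 0 by simp

lift_definition plus_ham4 :: "ham4 \<Rightarrow> ham4 \<Rightarrow> ham4" is "(+)"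
  by (metis (no_types, opaque_lifting) Un_iff keys_add subsetD)

lift_definition minus_ham4 :: "ham4 \<Rightarrow> ham4 \<Rightarrow> ham4" is "(-)"
  by (metis (no_types, opaque_lifting) Un_iff keys_minus_subset subsetD)

lift_definition uminus_ham4 :: "ham4 \<Rightarrow> ham4" is uminus
  by (simp add: in_keys_iff)

lift_definition scaleR_ham4 :: "real \<Rightarrow> ham4 \<Rightarrow> ham4" is "(*\<^sub>R)"
  by (auto simp: in_keys_iff lookup_scaleR')

instance
proof
  fix a b c :: ham4 and x y :: real
  show "a + b + c = a + (b + c)" by transfer (rule add.assoc)
  show "a + b = b + a" by transfer (rule add.commute)
  show "0 + a = a" by transfer (rule add_0_left)
  show "- a + a = 0" by transfer (rule left_minus)
  show "a - b = a + - b" by transfer (rule diff_conv_add_uminus)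
  show "x *\<^sub>R (a + b) = x *\<^sub>R a + x *\<^sub>R b" by transfer (rule scaleR_add_right)
  show "(x + y) *\<^sub>R a = x *\<^sub>R a + y *\<^sub>R a" by transfer (rule scaleR_add_left)
  show "x *\<^sub>R y *\<^sub>R a = (x * y) *\<^sub>R a" by transfer (rule scaleR_scaleR)
  show "1 *\<^sub>R a = a" by transfer (rule scaleR_one)
qed

end

lift_definition bracket :: "ham4 \<Rightarrow> ham4 \<Rightarrow> ham4" is poisson
proof -
  fix p q :: poly4 and C
  assume pq: "\<And>A. A \<in> Poly_Mapping.keys p \<Longrightarrow> 2 \<le> mdeg A"
      "\<And>A. A \<in> Poly_Mapping.keys q \<Longrightarrow> 2 \<le> mdeg A"
    and C: "C \<in> Poly_Mapping.keys (poisson p q)"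
  from C obtain A B where "A \<in> Poly_Mapping.keys p" "B \<in> Poly_Mapping.keys q" "mdeg C + 2 = mdeg A + mdeg B"
    by (rule keys_poisson)
  then show "2 \<le> mdeg C" using pq by fastforce
qed

lift_definition homogeneous :: "nat \<Rightarrow> ham4 \<Rightarrow> bool" is
  "\<lambda>l p. \<forall>A\<in>Poly_Mapping.keys p. mdeg A = l" .


section \<open>The exterior algebra\<close>

text \<open>A cochain is a function on lists of Lie algebra elements: an \<open>m\<close>-cochain \<open>\<sigma>\<close> is evaluated
  as \<open>\<sigma> [f\<^sub>1, \<dots>, f\<^sub>m]\<close>, and vanishes on lists of any other length.\<close>

type_synonym 'a form = "'a list \<Rightarrow> real"

definition unit_form :: "'a form" where
  "unit_form = (\<lambda>fs. if fs = [] then 1 else 0)"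

definition one_form :: "('a \<Rightarrow> real) \<Rightarrow> 'a form" where
  "one_form z = (\<lambda>fs. case fs of [f] \<Rightarrow> z f | _ \<Rightarrow> 0)"

text \<open>The product is the sum over shuffles: \<open>S\<close> is the set of positions of the arguments passed
  to the first factor, and the sign is that of the shuffle.  On one-forms this gives
  \<open>(z \<and> z')(f, g) = z f * z' g - z g * z' f\<close>.\<close>

definition wedge :: "'a form \<Rightarrow> 'a form \<Rightarrow> 'a form" where
  "wedge \<alpha> \<beta> = (\<lambda>fs. \<Sum>S\<in>Pow {..<length fs}.
     (-1) ^ card {(i, j). i \<in> S \<and> j \<in> {..<length fs} - S \<and> j < i}
       * \<alpha> (nths fs S) * \<beta> (nths fs ({..<length fs} - S)))"

definition interior_product :: "'a \<Rightarrow> 'a form \<Rightarrow> 'a form" where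
  "interior_product f \<sigma> = (\<lambda>fs. \<sigma> (f # fs))"

definition exterior_power :: "nat \<Rightarrow> 'a form set \<Rightarrow> 'a form set" where
  "exterior_power n V = span {foldr wedge zs unit_form | zs. length zs = n \<and> set zs \<subseteq> V}"

definition wedge_space :: "'a form set \<Rightarrow> 'a form set \<Rightarrow> 'a form set" where
  "wedge_space U V = span {wedge u v | u v. u \<in> U \<and> v \<in> V}"


section \<open>Gelfand--Fuks cochains\<close>

text \<open>The dual of the space of homogeneous polynomials of degree \<open>l\<close>, its elements being
  extended by zero to the other homogeneous components.\<close>

definition hom_dual :: "nat \<Rightarrow> ham4 form set" where
  "hom_dual l = {one_form z | z. linear z \<and> (\<forall>k f. homogeneous k f \<longrightarrow> k \<noteq> l \<longrightarrow> z f = 0)}"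

definition cochains :: "nat \<Rightarrow> ham4 form set" where
  "cochains m = exterior_power m (span (\<Union>l\<in>{2..}. hom_dual l))"

text \<open>A finite sequence \<open>(k\<^sub>2, k\<^sub>3, \<dots>, k\<^sub>s)\<close> is a list \<open>ks\<close> with \<open>ks ! i = k\<^bsub>i+2\<^esub>\<close>, so that the
  weight \<open>k\<^sub>l (l - 2)\<close> becomes \<open>ks ! i * i\<close>.  Appending zeros to \<open>ks\<close> does not change its type
  space, and different types are linearly independent, so the direct sum is the span of the
  union.\<close>

definition type_space :: "nat list \<Rightarrow> ham4 form set" where
  "type_space ks =
     foldr wedge_space (map (\<lambda>i. exterior_power (ks ! i) (hom_dual (i + 2))) [0..<length ks])
       (span {unit_form})"

definition weight_cochains :: "nat \<Rightarrow> nat \<Rightarrow> ham4 form set" where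
  "weight_cochains m w =
     span (\<Union>ks\<in>{ks. sum_list ks = m \<and> (\<Sum>i<length ks. ks ! i * i) = w}. type_space ks)"

text \<open>Linearity on all of \<open>ham4 form\<close> (rather than on cochains only) is immaterial: the values on
  cochains are already determined.  Existence and uniqueness are proved below as
  \<open>is_coboundary_coboundary\<close> and \<open>is_coboundary_unique\<close>.\<close>

definition is_coboundary :: "(ham4 form \<Rightarrow> ham4 form) \<Rightarrow> bool" where
  "is_coboundary d \<longleftrightarrow>
     linear d \<and>
     (\<forall>m. d ` cochains m \<subseteq> cochains (m + 1)) \<and>
     (\<forall>p q. \<forall>\<sigma>\<in>cochains p. \<forall>\<tau>\<in>cochains q.
        d (wedge \<sigma> \<tau>) = wedge (d \<sigma>) \<tau> + (-1) ^ p *\<^sub>R wedge \<sigma> (d \<tau>)) \<and>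
     (\<forall>z. one_form z \<in> cochains 1 \<longrightarrow>
        d (one_form z) = (\<lambda>fs. case fs of [f, g] \<Rightarrow> - z (bracket f g) | _ \<Rightarrow> 0))"

definition coboundary :: "ham4 form \<Rightarrow> ham4 form" where
  "coboundary = (SOME d. is_coboundary d)"


section \<open>Cochains relative to the symplectic group\<close>

definition sympl_matrix :: "real ^ 4 ^ 4" where
  "sympl_matrix = (\<chi> i j. if (i, j) \<in> {(1, 4), (2, 3)} then 1
     else if (i, j) \<in> {(3, 2), (4, 1)} then - 1 else 0)"

definition sp4 :: "(real ^ 4 ^ 4) set" where
  "sp4 = {\<xi>. transpose \<xi> ** sympl_matrix + sympl_matrix ** \<xi> = 0}"

text \<open>\<open>sp4\<close> is the Lie algebra of the group preserving \<open>\<omega>\<close>.  The function below is the component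
  \<open>x \<mapsto> \<langle>J(x), \<xi>\<rangle> = \<omega>(\<xi>x, x) / 2\<close> of the momentum mapping, where
  \<open>\<omega>(x, y) = x\<^sup>T \<Omega> y\<close> for the matrix \<open>\<Omega>\<close> above; it satisfies \<open>{x\<^sub>i, J \<xi>} = (\<xi>x)\<^sub>i\<close>.  By
  \<open>range_momentum\<close> below its range consists of all homogeneous quadratic polynomials.\<close>

lift_definition momentum :: "real ^ 4 ^ 4 \<Rightarrow> ham4" is
  "\<lambda>\<xi>. \<Sum>i\<in>UNIV. \<Sum>j\<in>UNIV.
     Poly_Mapping.single (axis i 1 + axis j 1) ((transpose \<xi> ** sympl_matrix) $ i $ j / 2)"
proof -
  fix \<xi> :: "real ^ 4 ^ 4" and A :: "nat ^ 4"
  assume "A \<in> Poly_Mapping.keys (\<Sum>i\<in>UNIV. \<Sum>j\<in>UNIV.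
     Poly_Mapping.single (axis i 1 + axis j 1) ((transpose \<xi> ** sympl_matrix) $ i $ j / 2))"
  then obtain i j :: 4 where "A = axis i 1 + axis j (1 :: nat)"
    by (auto simp: in_keys_iff lookup_sum lookup_single when_def
        elim!: sum.not_neutral_contains_not_neutral split: if_splits)
  then show "2 \<le> mdeg A" by (simp add: mdeg_add)
qed

definition rel_cochains :: "nat \<Rightarrow> nat \<Rightarrow> ham4 form set" where
  "rel_cochains m w = {\<sigma> \<in> weight_cochains m w. \<forall>\<xi>\<in>sp4.
     interior_product (momentum \<xi>) \<sigma> = 0 \<and> interior_product (momentum \<xi>) (coboundary \<sigma>) = 0}"

text \<open>\<open>Sum_any\<close> sums over the degrees in which the dimension is nonzero.\<close>

definition euler_number :: "nat \<Rightarrow> int" where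
  "euler_number w = Sum_any (\<lambda>m. (-1) ^ m * int (dim (rel_cochains m w)))"


section \<open>The exterior algebra: basic facts\<close>

definition shuffle_inv :: "nat \<Rightarrow> nat set \<Rightarrow> (nat \<times> nat) set" where
  "shuffle_inv n S = {(i, j). i \<in> S \<and> j \<in> {..<n} - S \<and> j < i}"

lemma finite_shuffle_inv: "S \<subseteq> {..<n} \<Longrightarrow> finite (shuffle_inv n S)"
  by (rule finite_subset[of _ "{..<n} \<times> {..<n}"]) (auto simp: shuffle_inv_def)

lemma card_shuffle_inv_insert:
  assumes "T \<subseteq> {..<n}"
  shows "card (shuffle_inv (Suc n) (insert 0 (Suc ` T))) = card (shuffle_inv n T)"
proof -
  have "shuffle_inv (Suc n) (insert 0 (Suc ` T)) = map_prod Suc Suc ` shuffle_inv n T"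
    unfolding shuffle_inv_def
    by (force simp: image_iff map_prod_def less_Suc_eq_0_disj)
  then show ?thesis by (simp add: card_image inj_on_def map_prod_def split: prod.splits)
qed

lemma card_shuffle_inv_image:
  assumes "T \<subseteq> {..<n}"
  shows "card (shuffle_inv (Suc n) (Suc ` T)) = card (shuffle_inv n T) + card T"
proof -
  have "shuffle_inv (Suc n) (Suc ` T) = map_prod Suc Suc ` shuffle_inv n T \<union> (\<lambda>i. (Suc i, 0)) ` T"
    unfolding shuffle_inv_def
    by (force simp: image_iff map_prod_def less_Suc_eq_0_disj)
  moreover have "card (map_prod Suc Suc ` shuffle_inv n T) = card (shuffle_inv n T)"
    by (simp add: card_image inj_on_def map_prod_def split: prod.splits)
  moreover have "card ((\<lambda>i. (Suc i, 0 :: nat)) ` T) = card T"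
    by (simp add: card_image inj_on_def)
  moreover have "map_prod Suc Suc ` shuffle_inv n T \<inter> (\<lambda>i. (Suc i, 0)) ` T = {}"
    by auto
  ultimately show ?thesis
    using assms finite_shuffle_inv[OF assms] finite_subset[OF assms]
    by (simp add: card_Un_disjoint)
qed

definition sign_inv :: "'a form \<Rightarrow> 'a form" where
  "sign_inv \<alpha> = (\<lambda>fs. (-1) ^ length fs * \<alpha> fs)"

lemma wedge_eq:
  "wedge \<alpha> \<beta> fs = (\<Sum>S\<in>Pow {..<length fs}. (-1) ^ card (shuffle_inv (length fs) S)
     * \<alpha> (nths fs S) * \<beta> (nths fs ({..<length fs} - S)))"
  by (simp add: wedge_def shuffle_inv_def)

lemma wedge_Nil: "wedge \<alpha> \<beta> [] = \<alpha> [] * \<beta> []"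
  by (simp add: wedge_eq shuffle_inv_def)

lemma wedge_Cons:
  "wedge \<alpha> \<beta> (f # fs) =
     wedge (interior_product f \<alpha>) \<beta> fs + wedge (sign_inv \<alpha>) (interior_product f \<beta>) fs"
proof -
  define n where "n = length fs"
  define F where "F S = (-1) ^ card (shuffle_inv (Suc n) S)
     * \<alpha> (nths (f # fs) S) * \<beta> (nths (f # fs) ({..<Suc n} - S))" for S
  have "Pow {..<Suc n} = image Suc ` Pow {..<n} \<union> (\<lambda>T. insert 0 (Suc ` T)) ` Pow {..<n}"
    unfolding lessThan_Suc_eq_insert_0 Pow_insert image_Pow_surj[OF refl, of Suc, symmetric]
    by (simp add: image_image)
  moreover have "image Suc ` Pow {..<n} \<inter> (\<lambda>T. insert 0 (Suc ` T)) ` Pow {..<n} = {}"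
    by auto
  ultimately have "sum F (Pow {..<Suc n}) =
      sum F (image Suc ` Pow {..<n}) + sum F ((\<lambda>T. insert 0 (Suc ` T)) ` Pow {..<n})"
    by (simp add: sum.union_disjoint)
  also have "sum F (image Suc ` Pow {..<n}) = (\<Sum>T\<in>Pow {..<n}. F (Suc ` T))"
    by (subst sum.reindex) (auto simp: inj_on_def inj_image_eq_iff)
  also have "sum F ((\<lambda>T. insert 0 (Suc ` T)) ` Pow {..<n}) = (\<Sum>T\<in>Pow {..<n}. F (insert 0 (Suc ` T)))"
  proof (subst sum.reindex)
    show "inj_on (\<lambda>T. insert 0 (Suc ` T)) (Pow {..<n})"
      by (rule inj_onI) (metis (no_types, lifting) Zero_not_Suc imageE inj_Suc inj_image_eq_iff insert_ident)
  qed simp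
  also have "(\<Sum>T\<in>Pow {..<n}. F (Suc ` T)) = wedge (sign_inv \<alpha>) (interior_product f \<beta>) fs"
    unfolding wedge_eq n_def[symmetric]
  proof (rule sum.cong)
    fix T assume "T \<in> Pow {..<n}"
    then have T: "T \<subseteq> {..<n}" by simp
    then have len: "length (nths fs T) = card T"
      unfolding length_nths n_def by (intro arg_cong[of _ _ card]) auto
    have "{j. Suc j \<in> Suc ` T} = T" by auto
    moreover have "{j. Suc j \<in> {..<Suc n} - Suc ` T} = {..<n} - T" by auto
    moreover have "0 \<in> {..<Suc n} - Suc ` T" by auto
    ultimately show "F (Suc ` T) = (-1) ^ card (shuffle_inv n T) * sign_inv \<alpha> (nths fs T)
        * interior_product f \<beta> (nths fs ({..<n} - T))"
      by (simp add: F_def nths_Cons card_shuffle_inv_image[OF T] sign_inv_def interior_product_def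
          len power_add image_iff)
  qed simp
  also have "(\<Sum>T\<in>Pow {..<n}. F (insert 0 (Suc ` T))) = wedge (interior_product f \<alpha>) \<beta> fs"
    unfolding wedge_eq n_def[symmetric]
  proof (rule sum.cong)
    fix T assume "T \<in> Pow {..<n}"
    then have T: "T \<subseteq> {..<n}" by simp
    have "{j. Suc j \<in> insert 0 (Suc ` T)} = T" by auto
    moreover have "{j. Suc j \<in> {..<Suc n} - insert 0 (Suc ` T)} = {..<n} - T" by auto
    ultimately show "F (insert 0 (Suc ` T)) = (-1) ^ card (shuffle_inv n T)
        * interior_product f \<alpha> (nths fs T) * \<beta> (nths fs ({..<n} - T))"
      by (simp add: F_def nths_Cons card_shuffle_inv_insert[OF T] interior_product_def)
  qed simp
  finally show ?thesis
    by (simp add: F_def wedge_eq[of _ _ "f # fs"] n_def)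
qed

lemma interior_wedge:
  "interior_product f (wedge \<alpha> \<beta>) =
     wedge (interior_product f \<alpha>) \<beta> + wedge (sign_inv \<alpha>) (interior_product f \<beta>)"
  by (simp add: fun_eq_iff interior_product_def[of f "wedge \<alpha> \<beta>"] wedge_Cons)

lemma wedge_add_left: "wedge (\<alpha> + \<alpha>') \<beta> = wedge \<alpha> \<beta> + wedge \<alpha>' \<beta>"
  by (simp add: fun_eq_iff wedge_def algebra_simps sum.distrib)

lemma wedge_add_right: "wedge \<alpha> (\<beta> + \<beta>') = wedge \<alpha> \<beta> + wedge \<alpha> \<beta>'"
  by (simp add: fun_eq_iff wedge_def algebra_simps sum.distrib)

lemma wedge_scaleR_left: "wedge (c *\<^sub>R \<alpha>) \<beta> = c *\<^sub>R wedge \<alpha> \<beta>"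
  by (simp add: fun_eq_iff wedge_def sum_distrib_left mult_ac)

lemma wedge_scaleR_right: "wedge \<alpha> (c *\<^sub>R \<beta>) = c *\<^sub>R wedge \<alpha> \<beta>"
  by (simp add: fun_eq_iff wedge_def sum_distrib_left mult_ac)

lemma wedge_minus_left: "wedge (- \<alpha>) \<beta> = - wedge \<alpha> \<beta>"
  by (simp add: fun_eq_iff wedge_def sum_negf)

lemma wedge_minus_right: "wedge \<alpha> (- \<beta>) = - wedge \<alpha> \<beta>"
  by (simp add: fun_eq_iff wedge_def sum_negf)

lemma wedge_diff_left: "wedge (\<alpha> - \<alpha>') \<beta> = wedge \<alpha> \<beta> - wedge \<alpha>' \<beta>"
  by (simp add: fun_eq_iff wedge_def algebra_simps sum_subtractf)

lemma wedge_diff_right: "wedge \<alpha> (\<beta> - \<beta>') = wedge \<alpha> \<beta> - wedge \<alpha> \<beta>'"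
  by (simp add: fun_eq_iff wedge_def algebra_simps sum_subtractf)

lemma linear_wedge_left: "linear (\<lambda>\<alpha>. wedge \<alpha> \<beta>)"
  by (intro linearI wedge_add_left wedge_scaleR_left)

lemma linear_wedge_right: "linear (wedge \<alpha>)"
  by (intro linearI wedge_add_right wedge_scaleR_right)

lemma sign_inv_wedge: "sign_inv (wedge \<alpha> \<beta>) = wedge (sign_inv \<alpha>) (sign_inv \<beta>)"
proof
  fix fs
  show "sign_inv (wedge \<alpha> \<beta>) fs = wedge (sign_inv \<alpha>) (sign_inv \<beta>) fs"
  proof (induction fs arbitrary: \<alpha> \<beta>)
    case Nil
    then show ?case by (simp add: sign_inv_def wedge_Nil)
  next
    case (Cons f fs)
    have i: "interior_product f (sign_inv \<gamma>) = - sign_inv (interior_product f \<gamma>)" for \<gamma>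
      by (simp add: fun_eq_iff sign_inv_def interior_product_def)
    have "sign_inv (wedge \<alpha> \<beta>) (f # fs) = - sign_inv (wedge (interior_product f \<alpha>) \<beta>) fs
        - sign_inv (wedge (sign_inv \<alpha>) (interior_product f \<beta>)) fs"
      by (simp add: sign_inv_def[of "wedge _ _"] wedge_Cons algebra_simps)
    then show ?case by (simp add: Cons i wedge_Cons wedge_minus_left wedge_minus_right)
  qed
qed

lemma wedge_assoc: "wedge (wedge \<alpha> \<beta>) \<gamma> = wedge \<alpha> (wedge \<beta> \<gamma>)"
proof
  fix fs
  show "wedge (wedge \<alpha> \<beta>) \<gamma> fs = wedge \<alpha> (wedge \<beta> \<gamma>) fs"
    by (induction fs arbitrary: \<alpha> \<beta> \<gamma>)
      (simp_all add: wedge_Nil wedge_Cons interior_wedge sign_inv_wedge wedge_add_left wedge_add_right)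
qed

lemma interior_unit [simp]: "interior_product f unit_form = 0"
  by (simp add: fun_eq_iff interior_product_def unit_form_def)

lemma sign_inv_unit [simp]: "sign_inv unit_form = unit_form"
  by (simp add: fun_eq_iff sign_inv_def unit_form_def)

lemma wedge_zero_left [simp]: "wedge 0 \<beta> = 0"
  by (simp add: fun_eq_iff wedge_def)

lemma wedge_zero_right [simp]: "wedge \<alpha> 0 = 0"
  by (simp add: fun_eq_iff wedge_def)

lemma wedge_unit_left [simp]: "wedge unit_form \<beta> = \<beta>"
proof
  fix fs show "wedge unit_form \<beta> fs = \<beta> fs"
    by (induction fs arbitrary: \<beta>)
      (simp_all add: wedge_Nil wedge_Cons, simp_all add: unit_form_def interior_product_def)
qed

lemma wedge_unit_right [simp]: "wedge \<alpha> unit_form = \<alpha>"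
proof
  fix fs show "wedge \<alpha> unit_form fs = \<alpha> fs"
    by (induction fs arbitrary: \<alpha>)
      (simp_all add: wedge_Nil wedge_Cons, simp_all add: unit_form_def interior_product_def)
qed


section \<open>The coboundary operator exists and is unique\<close>

text \<open>Cartan's formula as a recursive definition of the Chevalley--Eilenberg differential.\<close>

primrec lie_list :: "ham4 list \<Rightarrow> ham4 \<Rightarrow> ham4 form \<Rightarrow> real" where
  "lie_list [] f \<sigma> = 0"
| "lie_list (g # gs) f \<sigma> = lie_list gs f (interior_product g \<sigma>) - \<sigma> (bracket f g # gs)"

definition lie :: "ham4 \<Rightarrow> ham4 form \<Rightarrow> ham4 form" where
  "lie f \<sigma> = (\<lambda>gs. lie_list gs f \<sigma>)"

primrec ce_list :: "ham4 list \<Rightarrow> ham4 form \<Rightarrow> real" where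
  "ce_list [] \<sigma> = 0"
| "ce_list (f # fs) \<sigma> = lie f \<sigma> fs - ce_list fs (interior_product f \<sigma>)"

definition ce :: "ham4 form \<Rightarrow> ham4 form" where
  "ce \<sigma> = (\<lambda>fs. ce_list fs \<sigma>)"

lemma interior_add: "interior_product f (\<alpha> + \<beta>) = interior_product f \<alpha> + interior_product f \<beta>"
  by (simp add: fun_eq_iff interior_product_def)

lemma interior_scaleR: "interior_product f (c *\<^sub>R \<alpha>) = c *\<^sub>R interior_product f \<alpha>"
  by (simp add: fun_eq_iff interior_product_def)

lemma sign_inv_add: "sign_inv (\<alpha> + \<beta>) = sign_inv \<alpha> + sign_inv \<beta>"
  by (simp add: fun_eq_iff sign_inv_def algebra_simps)

lemma interior_sign_inv:
  "interior_product f (sign_inv \<alpha>) = - sign_inv (interior_product f \<alpha>)"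
  by (simp add: fun_eq_iff sign_inv_def interior_product_def)

lemma lie_Nil [simp]: "lie f \<sigma> [] = 0"
  by (simp add: lie_def)

lemma lie_Cons [simp]:
  "lie f \<sigma> (g # gs) = lie f (interior_product g \<sigma>) gs - interior_product (bracket f g) \<sigma> gs"
  by (simp add: lie_def interior_product_def)

lemma ce_Nil [simp]: "ce \<sigma> [] = 0"
  by (simp add: ce_def)

lemma ce_Cons [simp]: "ce \<sigma> (f # fs) = lie f \<sigma> fs - ce (interior_product f \<sigma>) fs"
  by (simp add: ce_def)

lemma interior_lie:
  "interior_product g (lie f \<sigma>) = lie f (interior_product g \<sigma>) - interior_product (bracket f g) \<sigma>"
  by (simp add: fun_eq_iff interior_product_def[of g "lie f \<sigma>"])

lemma interior_ce: "interior_product f (ce \<sigma>) = lie f \<sigma> - ce (interior_product f \<sigma>)"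
  by (simp add: fun_eq_iff interior_product_def[of f "ce \<sigma>"])

lemma lie_add: "lie f (\<alpha> + \<beta>) = lie f \<alpha> + lie f \<beta>"
proof
  fix fs show "lie f (\<alpha> + \<beta>) fs = (lie f \<alpha> + lie f \<beta>) fs"
    by (induction fs arbitrary: \<alpha> \<beta>) (simp_all add: interior_add)
qed

lemma lie_scaleR: "lie f (c *\<^sub>R \<alpha>) = c *\<^sub>R lie f \<alpha>"
proof
  fix fs show "lie f (c *\<^sub>R \<alpha>) fs = (c *\<^sub>R lie f \<alpha>) fs"
    by (induction fs arbitrary: \<alpha>) (simp_all add: interior_scaleR algebra_simps)
qed

lemma ce_add: "ce (\<alpha> + \<beta>) = ce \<alpha> + ce \<beta>"
proof
  fix fs show "ce (\<alpha> + \<beta>) fs = (ce \<alpha> + ce \<beta>) fs"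
    by (induction fs arbitrary: \<alpha> \<beta>) (simp_all add: interior_add lie_add)
qed

lemma ce_scaleR: "ce (c *\<^sub>R \<alpha>) = c *\<^sub>R ce \<alpha>"
proof
  fix fs show "ce (c *\<^sub>R \<alpha>) fs = (c *\<^sub>R ce \<alpha>) fs"
    by (induction fs arbitrary: \<alpha>) (simp_all add: interior_scaleR lie_scaleR algebra_simps)
qed

lemma linear_ce: "linear ce"
  by (intro linearI ce_add ce_scaleR)

lemma sign_inv_scaleR: "sign_inv (c *\<^sub>R \<alpha>) = c *\<^sub>R sign_inv \<alpha>"
  by (simp add: fun_eq_iff sign_inv_def)

lemma lie_minus: "lie f (- \<alpha>) = - lie f \<alpha>"
  using lie_scaleR[of f "-1" \<alpha>] by simp

lemma ce_minus: "ce (- \<alpha>) = - ce \<alpha>"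
  using ce_scaleR[of "-1" \<alpha>] by simp

lemma sign_inv_lie: "sign_inv (lie f \<alpha>) = lie f (sign_inv \<alpha>)"
proof
  fix fs show "sign_inv (lie f \<alpha>) fs = lie f (sign_inv \<alpha>) fs"
  proof (induction fs arbitrary: \<alpha>)
    case Nil
    then show ?case by (simp add: sign_inv_def)
  next
    case (Cons g fs)
    have "sign_inv (lie f \<alpha>) (g # fs) =
        - sign_inv (lie f (interior_product g \<alpha>)) fs + sign_inv (interior_product (bracket f g) \<alpha>) fs"
      by (simp add: sign_inv_def algebra_simps)
    then show ?case by (simp add: Cons interior_sign_inv lie_minus)
  qed
qed

lemma sign_inv_ce: "sign_inv (ce \<alpha>) = - ce (sign_inv \<alpha>)"
proof
  fix fs show "sign_inv (ce \<alpha>) fs = (- ce (sign_inv \<alpha>)) fs"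
  proof (induction fs arbitrary: \<alpha>)
    case Nil
    then show ?case by (simp add: sign_inv_def)
  next
    case (Cons g fs)
    have "sign_inv (ce \<alpha>) (g # fs) =
        - sign_inv (lie g \<alpha>) fs + sign_inv (ce (interior_product g \<alpha>)) fs"
      by (simp add: sign_inv_def algebra_simps)
    then show ?case by (simp add: Cons interior_sign_inv ce_minus sign_inv_lie)
  qed
qed

lemma lie_wedge: "lie f (wedge \<alpha> \<beta>) = wedge (lie f \<alpha>) \<beta> + wedge \<alpha> (lie f \<beta>)"
proof
  fix fs show "lie f (wedge \<alpha> \<beta>) fs = (wedge (lie f \<alpha>) \<beta> + wedge \<alpha> (lie f \<beta>)) fs"
  proof (induction fs arbitrary: \<alpha> \<beta>)
    case Nil
    then show ?case by (simp add: wedge_Nil)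
  next
    case (Cons g fs)
    show ?case
      by (simp add: wedge_Cons interior_wedge lie_add interior_lie Cons sign_inv_lie
          wedge_diff_left wedge_diff_right)
  qed
qed

lemma ce_wedge: "ce (wedge \<alpha> \<beta>) = wedge (ce \<alpha>) \<beta> + wedge (sign_inv \<alpha>) (ce \<beta>)"
proof
  fix fs show "ce (wedge \<alpha> \<beta>) fs = (wedge (ce \<alpha>) \<beta> + wedge (sign_inv \<alpha>) (ce \<beta>)) fs"
  proof (induction fs arbitrary: \<alpha> \<beta>)
    case Nil
    then show ?case by (simp add: wedge_Nil)
  next
    case (Cons g fs)
    have s: "sign_inv (sign_inv \<alpha>) = \<alpha>"
      by (simp add: fun_eq_iff sign_inv_def flip: power_mult_distrib)
    show ?case
      by (simp add: wedge_Cons interior_wedge lie_wedge ce_add interior_ce Cons sign_inv_ce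
          interior_sign_inv s wedge_diff_left wedge_diff_right wedge_minus_left wedge_minus_right)
  qed
qed

lemma wedge_span:
  assumes "u \<in> span U" "v \<in> span V"
  shows "wedge u v \<in> span {wedge a b | a b. a \<in> U \<and> b \<in> V}"
    (is "_ \<in> ?W")
proof -
  have 1: "wedge u b \<in> ?W" if b: "b \<in> V" for b
  proof -
    have "subspace ((\<lambda>\<alpha>. wedge \<alpha> b) -` ?W)"
      by (intro linear_subspace_vimage linear_wedge_left subspace_span)
    moreover have "U \<subseteq> (\<lambda>\<alpha>. wedge \<alpha> b) -` ?W"
      using b by (auto intro!: span_base)
    ultimately show ?thesis using span_minimal assms(1) by blast
  qed
  have "subspace (wedge u -` ?W)"
    by (intro linear_subspace_vimage linear_wedge_right subspace_span)
  moreover have "V \<subseteq> wedge u -` ?W" using 1 by auto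
  ultimately show ?thesis using span_minimal assms(2) by blast
qed

lemma foldr_wedge_append:
  "foldr wedge (xs @ ys) unit_form = wedge (foldr wedge xs unit_form) (foldr wedge ys unit_form)"
  by (induction xs) (simp_all add: wedge_assoc)

lemma exterior_power_wedge:
  assumes "\<sigma> \<in> exterior_power p V" "\<tau> \<in> exterior_power q V"
  shows "wedge \<sigma> \<tau> \<in> exterior_power (p + q) V"
proof -
  have "wedge \<sigma> \<tau> \<in> span {wedge a b | a b.
      a \<in> {foldr wedge zs unit_form | zs. length zs = p \<and> set zs \<subseteq> V} \<and>
      b \<in> {foldr wedge zs unit_form | zs. length zs = q \<and> set zs \<subseteq> V}}"
    using assms unfolding exterior_power_def by (rule wedge_span)
  also have "\<dots> \<subseteq> exterior_power (p + q) V"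
    unfolding exterior_power_def
  proof (intro span_mono subsetI, safe)
    fix xs ys assume "set xs \<subseteq> V" "set ys \<subseteq> V" "p = length xs" "q = length ys"
    then show "\<exists>zs. wedge (foldr wedge xs unit_form) (foldr wedge ys unit_form) =
        foldr wedge zs unit_form \<and> length zs = length xs + length ys \<and> set zs \<subseteq> V"
      by (intro exI[of _ "xs @ ys"]) (simp add: foldr_wedge_append del: foldr_append)
  qed
  finally show ?thesis .
qed

lemma subspace_exterior_power: "subspace (exterior_power n V)"
  by (simp add: exterior_power_def)

lemma exterior_power_mono: "V \<subseteq> W \<Longrightarrow> exterior_power n V \<subseteq> exterior_power n W"
  unfolding exterior_power_def by (intro span_mono) auto

lemma unit_in_exterior_power: "unit_form \<in> exterior_power 0 V"
  unfolding exterior_power_def by (intro span_base) auto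

lemma exterior_power_0: "exterior_power 0 V = span {unit_form}"
  by (simp add: exterior_power_def)

lemma in_exterior_power_1: "z \<in> V \<Longrightarrow> z \<in> exterior_power 1 V"
  unfolding exterior_power_def by (intro span_base) (auto intro!: exI[of _ "[z]"])

lemma exterior_power_Suc:
  assumes "z \<in> V" "\<sigma> \<in> exterior_power n V"
  shows "wedge z \<sigma> \<in> exterior_power (Suc n) V"
  using exterior_power_wedge[OF in_exterior_power_1 assms(2)] assms(1) by simp

lemma exterior_power_span: "exterior_power n (span V) = exterior_power n V"
proof
  have "foldr wedge zs unit_form \<in> exterior_power (length zs) V" if "set zs \<subseteq> span V" for zs
    using that
  proof (induction zs)
    case Nil
    then show ?case by (simp add: unit_in_exterior_power)
  next
    case (Cons z zs)
    then have "z \<in> span V" by simp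
    moreover have "span V \<subseteq> exterior_power 1 V"
      by (intro span_minimal subspace_exterior_power subsetI in_exterior_power_1)
    ultimately have "z \<in> exterior_power 1 V" by blast
    with Cons exterior_power_wedge[of z 1 V _ "length zs"] show ?case by simp
  qed
  then have "{foldr wedge zs unit_form | zs. length zs = n \<and> set zs \<subseteq> span V} \<subseteq> exterior_power n V"
    by auto
  then show "exterior_power n (span V) \<subseteq> exterior_power n V"
    unfolding exterior_power_def[of n "span V"]
    by (intro span_minimal subspace_exterior_power)
qed (intro exterior_power_mono span_superset)

lemma exterior_power_finite:
  assumes "finite V"
  obtains B where "finite B" "exterior_power n V = span B"
proof
  have "finite {zs. set zs \<subseteq> V \<and> length zs = n}"
    using assms by (rule finite_lists_length_eq)
  then have "finite ((\<lambda>zs. foldr wedge zs unit_form) ` {zs. set zs \<subseteq> V \<and> length zs = n})"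
    by (rule finite_imageI)
  also have "(\<lambda>zs. foldr wedge zs unit_form) ` {zs. set zs \<subseteq> V \<and> length zs = n} =
      {foldr wedge zs unit_form | zs. length zs = n \<and> set zs \<subseteq> V}"
    by auto
  finally show "finite {foldr wedge zs unit_form | zs. length zs = n \<and> set zs \<subseteq> V}" .
qed (simp add: exterior_power_def)

definition degree_forms :: "nat \<Rightarrow> 'a form set" where
  "degree_forms n = {\<sigma>. \<forall>fs. length fs \<noteq> n \<longrightarrow> \<sigma> fs = 0}"

lemma subspace_degree_forms: "subspace (degree_forms n)"
  by (auto simp: subspace_def degree_forms_def)

lemma degree_forms_wedge:
  assumes "\<alpha> \<in> degree_forms p" "\<beta> \<in> degree_forms q"
  shows "wedge \<alpha> \<beta> \<in> degree_forms (p + q)"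
  unfolding degree_forms_def
proof safe
  fix fs :: "'a list" assume len: "length fs \<noteq> p + q"
  have "\<alpha> (nths fs S) * \<beta> (nths fs ({..<length fs} - S)) = 0" if S: "S \<subseteq> {..<length fs}" for S
  proof -
    have "length (nths fs S) = card S"
      unfolding length_nths using S by (intro arg_cong[of _ _ card]) auto
    moreover have "length (nths fs ({..<length fs} - S)) = card ({..<length fs} - S)"
      unfolding length_nths by (intro arg_cong[of _ _ card]) auto
    moreover have "card S + card ({..<length fs} - S) = length fs"
      using S by (metis card_Diff_subset card_lessThan card_mono finite_lessThan finite_subset
          le_add_diff_inverse)
    ultimately have "length (nths fs S) \<noteq> p \<or> length (nths fs ({..<length fs} - S)) \<noteq> q"
      using len by linarith
    then show ?thesis using assms by (auto simp: degree_forms_def)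
  qed
  then show "wedge \<alpha> \<beta> fs = 0"
    unfolding wedge_eq mult.assoc by (intro sum.neutral) auto
qed

lemma one_form_degree: "one_form z \<in> degree_forms 1"
  by (auto simp: degree_forms_def one_form_def split: list.splits)

lemma exterior_power_degree:
  assumes "V \<subseteq> degree_forms 1"
  shows "exterior_power n V \<subseteq> degree_forms n"
proof -
  have "foldr wedge zs unit_form \<in> degree_forms (length zs)" if "set zs \<subseteq> V" for zs
    using that
  proof (induction zs)
    case Nil
    then show ?case by (simp add: degree_forms_def unit_form_def)
  next
    case (Cons z zs)
    then show ?case using degree_forms_wedge[of z 1 _ "length zs"] assms by auto
  qed
  then show ?thesis
    unfolding exterior_power_def by (intro span_minimal subspace_degree_forms) auto
qed

lemma hom_dual_subset: "hom_dual l \<subseteq> range one_form"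
  by (auto simp: hom_dual_def)

lemma subspace_one_forms: "subspace (range one_form)"
  unfolding subspace_def
proof safe
  show "0 \<in> range one_form"
    by (auto simp: one_form_def fun_eq_iff split: list.splits intro!: image_eqI[of _ _ "\<lambda>_. 0"])
next
  fix u v :: "'a \<Rightarrow> real"
  show "one_form u + one_form v \<in> range one_form"
    by (auto simp: one_form_def fun_eq_iff split: list.splits intro!: image_eqI[of _ _ "u + v"])
next
  fix c and u :: "'a \<Rightarrow> real"
  show "c *\<^sub>R one_form u \<in> range one_form"
    by (auto simp: one_form_def fun_eq_iff split: list.splits intro!: image_eqI[of _ _ "c *\<^sub>R u"])
qed

lemma span_hom_dual_subset: "span (\<Union>l\<in>L. hom_dual l) \<subseteq> range one_form"
  using hom_dual_subset by (intro span_minimal subspace_one_forms) auto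

lemma cochains_degree: "cochains m \<subseteq> degree_forms m"
  unfolding cochains_def using span_hom_dual_subset one_form_degree
  by (intro exterior_power_degree) fast

lemma cochains_wedge: "\<sigma> \<in> cochains p \<Longrightarrow> \<tau> \<in> cochains q \<Longrightarrow> wedge \<sigma> \<tau> \<in> cochains (p + q)"
  unfolding cochains_def by (rule exterior_power_wedge)

lemma subspace_cochains: "subspace (cochains m)"
  by (simp add: cochains_def subspace_exterior_power)

lemma cochains_eq: "cochains m = exterior_power m (\<Union>l\<in>{2..}. hom_dual l)"
  by (simp add: cochains_def exterior_power_span)

lemma sign_inv_cochains: "\<sigma> \<in> cochains p \<Longrightarrow> sign_inv \<sigma> = (-1) ^ p *\<^sub>R \<sigma>"
  using cochains_degree[of p] by (fastforce simp: fun_eq_iff sign_inv_def degree_forms_def)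

lemma interior_one_form: "interior_product f (one_form z) = z f *\<^sub>R unit_form"
  by (auto simp: fun_eq_iff interior_product_def one_form_def unit_form_def split: list.splits)

lemma lie_zero: "lie f 0 = 0"
  using lie_scaleR[of f 0 0] by simp

lemma ce_zero: "ce 0 = 0"
  using ce_scaleR[of 0 0] by simp

lemma lie_unit: "lie f unit_form = 0"
proof
  fix fs show "lie f unit_form fs = 0 fs"
    by (cases fs) (simp_all add: lie_zero)
qed

lemma ce_unit: "ce unit_form = 0"
proof
  fix fs show "ce unit_form fs = 0 fs"
    by (cases fs) (simp_all add: lie_unit ce_zero)
qed

lift_definition monomial :: "nat ^ 4 \<Rightarrow> ham4" is
  "\<lambda>A. if 2 \<le> mdeg A then Poly_Mapping.single A 1 else 0"
  by (auto split: if_splits)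

lift_definition coord :: "nat ^ 4 \<Rightarrow> ham4 \<Rightarrow> real" is "\<lambda>A p. Poly_Mapping.lookup p A" .

lift_definition support :: "ham4 \<Rightarrow> (nat ^ 4) set" is Poly_Mapping.keys .

lemma ham4_eqI: "(\<And>A. coord A f = coord A g) \<Longrightarrow> f = g"
  by transfer (rule poly_mapping_eqI)

lemma linear_coord: "linear (coord A)"
  by (rule linearI; transfer) (simp_all add: lookup_add lookup_scaleR')

lemma finite_support: "finite (support f)"
  by transfer simp

lemma support_eq: "support f = {A. coord A f \<noteq> 0}"
  by transfer (auto simp: in_keys_iff)

lemma coord_low: "mdeg A < 2 \<Longrightarrow> coord A f = 0"
  by transfer (force simp: in_keys_iff)

lemma coord_monomial: "coord A (monomial B) = (if A = B \<and> 2 \<le> mdeg A then 1 else 0)"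
  by transfer (auto simp: lookup_single when_def)

lemma homogeneous_iff: "homogeneous l f \<longleftrightarrow> (\<forall>A. mdeg A \<noteq> l \<longrightarrow> coord A f = 0)"
  by transfer (auto simp: in_keys_iff)

lemma homogeneous_monomial: "homogeneous (mdeg A) (monomial A)"
  by (auto simp: homogeneous_iff coord_monomial)

lemma ham4_expand:
  assumes "finite M" "support f \<subseteq> M"
  shows "f = (\<Sum>A\<in>M. coord A f *\<^sub>R monomial A)"
proof (rule ham4_eqI)
  fix C
  have "coord C (\<Sum>A\<in>M. coord A f *\<^sub>R monomial A) =
      (\<Sum>A\<in>M. coord A f * coord C (monomial A))"
    by (simp add: linear_sum[OF linear_coord] linear_cmul[OF linear_coord])
  also have "\<dots> = (\<Sum>A\<in>M. if A = C then coord C f else 0)"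
    using coord_low[of C f] by (intro sum.cong) (auto simp: coord_monomial not_le)
  also have "\<dots> = coord C f"
    using assms by (auto simp: support_eq)
  finally show "coord C f = coord C (\<Sum>A\<in>M. coord A f *\<^sub>R monomial A)" ..
qed

lemma bracket_skew: "bracket f g = - bracket g f"
  by transfer (rule poisson_skew)

lemma bracket_linear_left: "linear (\<lambda>f. bracket f g)"
  by (rule linearI; transfer) (simp_all add: poisson_add_left poisson_scaleR_left)

lemma bracket_linear_right: "linear (bracket f)"
proof -
  have "bracket f = (\<lambda>g. - bracket g f)" by (rule ext) (rule bracket_skew)
  then show ?thesis using linear_compose_neg[OF bracket_linear_left] by simp
qed

lemma homogeneous_bracket:
  assumes "homogeneous k f" "homogeneous l g"
  shows "homogeneous (k + l - 2) (bracket f g)"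
  using assms
proof (transfer, intro ballI)
  fix k l and p q :: poly4 and C
  assume "\<forall>A\<in>Poly_Mapping.keys p. mdeg A = k" "\<forall>A\<in>Poly_Mapping.keys q. mdeg A = l"
    and C: "C \<in> Poly_Mapping.keys (poisson p q)"
  with keys_poisson[OF C] have "mdeg C + 2 = k + l" by metis
  then show "mdeg C = k + l - 2" by simp
qed

lemma coord_in_hom_dual: "one_form (coord A) \<in> hom_dual (mdeg A)"
  unfolding hom_dual_def mem_Collect_eq
proof (intro exI conjI allI impI)
  show "linear (coord A)" by (rule linear_coord)
  show "coord A f = 0" if "homogeneous k f" "k \<noteq> mdeg A" for k f
    using that by (simp add: homogeneous_iff)
qed (rule refl)

lemma hom_dual_apply:
  assumes "finite M" "support f \<subseteq> M" "linear z"
  shows "z f = (\<Sum>A\<in>M. coord A f * z (monomial A))"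
proof -
  have "z f = z (\<Sum>A\<in>M. coord A f *\<^sub>R monomial A)"
    using ham4_expand[OF assms(1,2)] by (rule arg_cong)
  also have "\<dots> = (\<Sum>A\<in>M. coord A f * z (monomial A))"
    by (simp add: linear_sum[OF assms(3)] linear_cmul[OF assms(3)])
  finally show ?thesis .
qed

lemma hom_dual_span:
  "hom_dual l \<subseteq> span ((\<lambda>A. one_form (coord A)) ` {A. mdeg A = l})"
proof
  fix \<zeta> assume "\<zeta> \<in> hom_dual l"
  then obtain z where z: "\<zeta> = one_form z" "linear z"
      "\<And>k f. homogeneous k f \<Longrightarrow> k \<noteq> l \<Longrightarrow> z f = 0"
    unfolding hom_dual_def mem_Collect_eq by metis
  define K where "K = {A. mdeg A = l}"
  have fin: "finite K"
    unfolding K_def by (rule finite_subset[OF _ finite_mdeg_le[of l]]) auto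
  have "z f = (\<Sum>A\<in>K. z (monomial A) * coord A f)" for f
  proof -
    have "z f = (\<Sum>A\<in>support f \<union> K. coord A f * z (monomial A))"
      by (rule hom_dual_apply) (simp_all add: fin finite_support z(2))
    also have "\<dots> = (\<Sum>A\<in>K. coord A f * z (monomial A))"
    proof (rule sum.mono_neutral_right)
      show "\<forall>A\<in>support f \<union> K - K. coord A f * z (monomial A) = 0"
        using z(3)[OF homogeneous_monomial] by (simp add: K_def)
    qed (simp_all add: fin finite_support)
    finally show ?thesis by (simp add: mult.commute)
  qed
  then have z_eq: "z = (\<lambda>f. \<Sum>A\<in>K. z (monomial A) * coord A f)" by (rule ext)
  have "one_form (\<lambda>f. \<Sum>A\<in>K. c A * coord A f) fs = (\<Sum>A\<in>K. c A *\<^sub>R one_form (coord A)) fs"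
    for c fs
    by (simp add: one_form_def split: list.split)
  then have "\<zeta> = (\<Sum>A\<in>K. z (monomial A) *\<^sub>R one_form (coord A))"
    unfolding z(1) by (subst z_eq) (rule ext)
  then show "\<zeta> \<in> span ((\<lambda>A. one_form (coord A)) ` {A. mdeg A = l})"
    unfolding K_def[symmetric] by (simp only:) (intro span_sum span_scale span_base imageI)
qed

lemma wedge_one_forms:
  "wedge (one_form u) (one_form v) [f, g] = u f * v g - u g * v f"
  by (simp add: wedge_Cons wedge_Nil sign_inv_def interior_product_def one_form_def)

definition dual_bracket :: "(ham4 \<Rightarrow> real) \<Rightarrow> ham4 form" where
  "dual_bracket z = (\<lambda>fs. case fs of [f, g] \<Rightarrow> - z (bracket f g) | _ \<Rightarrow> 0)"

lemma ce_one_form: "ce (one_form z) = dual_bracket z"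
proof
  fix fs
  have l: "lie f (one_form z) = one_form (\<lambda>g. - z (bracket f g))" for f
  proof
    fix gs show "lie f (one_form z) gs = one_form (\<lambda>g. - z (bracket f g)) gs"
      by (cases gs) (auto simp: interior_one_form lie_scaleR lie_unit,
        auto simp: one_form_def unit_form_def split: list.splits)
  qed
  show "ce (one_form z) fs = dual_bracket z fs"
    by (cases fs) (auto simp: dual_bracket_def interior_one_form ce_scaleR ce_unit l,
        auto simp: one_form_def split: list.splits)
qed

lemma dual_bracket_cochain:
  assumes "one_form z \<in> hom_dual l"
  shows "dual_bracket z \<in> cochains 2"
proof -
  have "z = z'" if "one_form z = one_form z'" for z'
  proof
    fix f show "z f = z' f" using fun_cong[OF that, of "[f]"] by (simp add: one_form_def)
  qed
  with assms have lin: "linear z" and hom: "\<And>k f. homogeneous k f \<Longrightarrow> k \<noteq> l \<Longrightarrow> z f = 0"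
    by (auto simp: hom_dual_def)
  define K where "K = {A. 2 \<le> mdeg A \<and> mdeg A \<le> l}"
  have fin: "finite K"
    unfolding K_def by (rule finite_subset[OF _ finite_mdeg_le[of l]]) auto
  define c where "c A B = z (bracket (monomial A) (monomial B))" for A B
  have c_skew: "c A B = - c B A" for A B
    unfolding c_def by (subst bracket_skew) (simp add: linear_neg[OF lin])
  have c_zero: "c A B = 0" if "mdeg A + mdeg B - 2 \<noteq> l" for A B
    unfolding c_def using that homogeneous_bracket[OF homogeneous_monomial homogeneous_monomial]
    by (intro hom)
  have expand: "z (bracket f g) = (\<Sum>A\<in>K. \<Sum>B\<in>K. coord A f * coord B g * c A B)" for f g
  proof -
    define M where "M = support f \<union> support g \<union> K"
    have M: "finite M" "support f \<subseteq> M" "support g \<subseteq> M" "K \<subseteq> M"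
      using fin finite_support by (auto simp: M_def)
    have low: "2 \<le> mdeg A" if "A \<in> M" for A
      using that coord_low[of A f] coord_low[of A g]
      by (auto simp: M_def K_def support_eq not_le[symmetric])
    have b: "bracket f g = (\<Sum>A\<in>M. \<Sum>B\<in>M. (coord A f * coord B g) *\<^sub>R bracket (monomial A) (monomial B))"
    proof -
      have "bracket f g = (\<Sum>A\<in>M. coord A f *\<^sub>R bracket (monomial A) g)"
        by (subst ham4_expand[OF M(1,2)])
          (simp add: linear_sum[OF bracket_linear_left] linear_cmul[OF bracket_linear_left])
      moreover have "bracket h g = (\<Sum>B\<in>M. coord B g *\<^sub>R bracket h (monomial B))" for h
        by (subst ham4_expand[OF M(1,3)])
          (simp add: linear_sum[OF bracket_linear_right] linear_cmul[OF bracket_linear_right])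
      ultimately show ?thesis by (simp add: scaleR_sum_right)
    qed
    have "z (bracket f g) = (\<Sum>A\<in>M. \<Sum>B\<in>M. coord A f * coord B g * c A B)"
      unfolding b by (simp add: linear_sum[OF lin] linear_cmul[OF lin] c_def)
    also have "\<dots> = (\<Sum>A\<in>M. \<Sum>B\<in>K. coord A f * coord B g * c A B)"
    proof (rule sum.cong[OF refl], rule sum.mono_neutral_right[OF M(1,4)], rule ballI)
      fix A B assume "A \<in> M" "B \<in> M - K"
      then have "mdeg A + mdeg B - 2 \<noteq> l" using low[of A] low[of B] by (auto simp: K_def)
      then show "coord A f * coord B g * c A B = 0" by (simp add: c_zero)
    qed
    also have "\<dots> = (\<Sum>A\<in>K. \<Sum>B\<in>K. coord A f * coord B g * c A B)"
    proof (rule sum.mono_neutral_right[OF M(1,4)], rule ballI, rule sum.neutral, rule ballI)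
      fix A B assume "A \<in> M - K" "B \<in> K"
      then have "mdeg A + mdeg B - 2 \<noteq> l" using low[of A] M(4) low[of B] by (auto simp: K_def)
      then show "coord A f * coord B g * c A B = 0" by (simp add: c_zero)
    qed
    finally show ?thesis .
  qed
  define \<rho> where "\<rho> = (\<Sum>A\<in>K. \<Sum>B\<in>K. (- c A B / 2) *\<^sub>R wedge (one_form (coord A)) (one_form (coord B)))"
  have "\<rho> \<in> cochains 2"
    unfolding \<rho>_def
  proof (intro subspace_sum subspace_cochains subspace_scale)
    fix A B assume "A \<in> K" "B \<in> K"
    moreover have "one_form (coord C) \<in> cochains 1" if "C \<in> K" for C
      unfolding cochains_eq
      by (rule in_exterior_power_1) (use coord_in_hom_dual[of C] that in \<open>auto simp: K_def\<close>)
    ultimately have "one_form (coord A) \<in> cochains 1" "one_form (coord B) \<in> cochains 1"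
      by blast+
    from cochains_wedge[OF this] show "wedge (one_form (coord A)) (one_form (coord B)) \<in> cochains 2"
      by (simp only: one_add_one)
  qed
  moreover have "\<rho> = dual_bracket z"
  proof
    fix fs
    show "\<rho> fs = dual_bracket z fs"
    proof (cases "length fs = 2")
      case False
      with \<open>\<rho> \<in> cochains 2\<close> cochains_degree[of 2] have "\<rho> fs = 0" by (auto simp: degree_forms_def)
      with False show ?thesis by (auto simp: dual_bracket_def split: list.splits)
    next
      case True
      then obtain f g where fs: "fs = [f, g]"
        by (auto simp: length_Suc_conv numeral_2_eq_2)
      have sw: "(\<Sum>A\<in>K. \<Sum>B\<in>K. coord A g * coord B f * c A B) = - z (bracket f g)"
        using expand[of g f] bracket_skew[of g f] linear_neg[OF lin] by metis
      have "\<rho> fs = (\<Sum>A\<in>K. \<Sum>B\<in>K. (- 1 / 2) * (coord A f * coord B g * c A B)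
          + (1 / 2) * (coord A g * coord B f * c A B))"
        unfolding \<rho>_def fs sum_fun_apply'
        by (intro sum.cong refl) (simp add: wedge_one_forms field_simps)
      also have "\<dots> = - 1 / 2 * z (bracket f g) + 1 / 2 * - z (bracket f g)"
        unfolding sum.distrib sum_distrib_left[symmetric] sw expand[of f g, symmetric] ..
      finally show ?thesis by (simp add: fs dual_bracket_def)
    qed
  qed
  ultimately show ?thesis by simp
qed

lemma ce_cochains: "\<sigma> \<in> cochains m \<Longrightarrow> ce \<sigma> \<in> cochains (m + 1)"
proof -
  define V where "V = (\<Union>l\<in>{2..}. hom_dual l)"
  have "ce (foldr wedge zs unit_form) \<in> cochains (length zs + 1)" if "set zs \<subseteq> V" for zs
    using that
  proof (induction zs)
    case Nil
    show ?case
      using subspace_0[OF subspace_cochains] by (simp only: foldr.simps id_apply ce_unit)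
  next
    case (Cons z zs)
    let ?\<tau> = "foldr wedge zs unit_form"
    have \<tau>: "?\<tau> \<in> cochains (length zs)"
      using Cons.prems unfolding cochains_eq V_def[symmetric] exterior_power_def
      by (intro span_base) auto
    obtain l z' where z': "z = one_form z'" "one_form z' \<in> hom_dual l"
      using Cons.prems by (auto simp: V_def hom_dual_def)
    have z: "z \<in> cochains 1"
      using Cons.prems unfolding cochains_eq V_def[symmetric] by (intro in_exterior_power_1) auto
    have "ce z \<in> cochains 2"
      using dual_bracket_cochain[OF z'(2)] by (simp add: z'(1) ce_one_form)
    from cochains_wedge[OF this \<tau>] have 1: "wedge (ce z) ?\<tau> \<in> cochains (length (z # zs) + 1)"
      by simp
    have "ce ?\<tau> \<in> cochains (length zs + 1)" using Cons by simp
    from cochains_wedge[OF z this] have 2: "wedge z (ce ?\<tau>) \<in> cochains (length (z # zs) + 1)"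
      by simp
    have "ce (wedge z ?\<tau>) = wedge (ce z) ?\<tau> - wedge z (ce ?\<tau>)"
      by (simp add: ce_wedge sign_inv_cochains[OF z] wedge_minus_left)
    then show ?case
      using subspace_diff[OF subspace_cochains 1 2] by (simp only: foldr.simps comp_apply)
  qed
  then have "{foldr wedge zs unit_form | zs. length zs = m \<and> set zs \<subseteq> V} \<subseteq> ce -` cochains (m + 1)"
    by auto
  then have "cochains m \<subseteq> ce -` cochains (m + 1)"
    unfolding cochains_eq[of m] V_def[symmetric] exterior_power_def[of m]
    by (intro span_minimal linear_subspace_vimage linear_ce subspace_cochains)
  then show "\<sigma> \<in> cochains m \<Longrightarrow> ce \<sigma> \<in> cochains (m + 1)" by blast
qed

lemma is_coboundary_ce: "is_coboundary ce"
  unfolding is_coboundary_def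
proof (intro conjI allI ballI impI)
  show "linear ce" by (rule linear_ce)
  show "ce ` cochains m \<subseteq> cochains (m + 1)" for m using ce_cochains by blast
  show "ce (one_form z) = (\<lambda>fs. case fs of [f, g] \<Rightarrow> - z (bracket f g) | _ \<Rightarrow> 0)" for z
    unfolding ce_one_form dual_bracket_def ..
  show "ce (wedge \<sigma> \<tau>) = wedge (ce \<sigma>) \<tau> + (-1) ^ p *\<^sub>R wedge \<sigma> (ce \<tau>)"
    if "\<sigma> \<in> cochains p" for p \<sigma> \<tau>
    unfolding ce_wedge sign_inv_cochains[OF that] wedge_scaleR_left ..
qed

lemma is_coboundary_unique:
  assumes d: "is_coboundary d" and d': "is_coboundary d'" and \<sigma>: "\<sigma> \<in> cochains m"
  shows "d \<sigma> = d' \<sigma>"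
proof -
  define V where "V = span (\<Union>l\<in>{2..}. hom_dual l)"
  have leibniz: "\<delta> (wedge \<sigma> \<tau>) = wedge (\<delta> \<sigma>) \<tau> + (-1) ^ p *\<^sub>R wedge \<sigma> (\<delta> \<tau>)"
    if "is_coboundary \<delta>" "\<sigma> \<in> cochains p" "\<tau> \<in> cochains q" for \<delta> \<sigma> \<tau> p q
    using that unfolding is_coboundary_def by blast
  have unit: "unit_form \<in> cochains 0"
    unfolding cochains_def by (rule unit_in_exterior_power)
  have \<delta>_unit: "\<delta> unit_form = 0" if "is_coboundary \<delta>" for \<delta>
    using leibniz[OF that unit unit] by simp
  have "d (foldr wedge zs unit_form) = d' (foldr wedge zs unit_form)" if "set zs \<subseteq> V" for zs
    using that
  proof (induction zs)
    case Nil
    then show ?case using \<delta>_unit d d' by simp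
  next
    case (Cons z zs)
    let ?\<tau> = "foldr wedge zs unit_form"
    have \<tau>: "?\<tau> \<in> cochains (length zs)"
      using Cons.prems unfolding cochains_def V_def[symmetric] exterior_power_def
      by (intro span_base) auto
    have z: "z \<in> cochains 1"
      using Cons.prems unfolding cochains_def V_def[symmetric] by (intro in_exterior_power_1) auto
    obtain z' where z': "z = one_form z'"
      using Cons.prems span_hom_dual_subset by (fastforce simp: V_def)
    have "d z = d' z"
      using d d' z unfolding is_coboundary_def z' by auto
    then show ?case
      using Cons leibniz[OF d z \<tau>] leibniz[OF d' z \<tau>] by simp
  qed
  then show ?thesis
    using \<sigma> d d' unfolding cochains_def V_def[symmetric] exterior_power_def is_coboundary_def
    by (elim conjE) (rule linear_eq_on_span[of d d'], auto)
qed

lemma is_coboundary_coboundary: "is_coboundary coboundary"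
  unfolding coboundary_def using is_coboundary_ce by (rule someI[of is_coboundary])

lemma wedge_space_mono_power:
  assumes "U \<subseteq> exterior_power p V" "W \<subseteq> exterior_power q V"
  shows "wedge_space U W \<subseteq> exterior_power (p + q) V"
  unfolding wedge_space_def
  using assms by (intro span_minimal subspace_exterior_power) (blast intro: exterior_power_wedge)

lemma type_space_subset:
  assumes "\<And>i. i < length ks \<Longrightarrow> ks ! i = 0 \<or> hom_dual (i + 2) \<subseteq> V"
  shows "type_space ks \<subseteq> exterior_power (sum_list ks) V"
proof -
  have "foldr wedge_space (map (\<lambda>i. exterior_power (ks ! i) (hom_dual (i + 2))) is) (span {unit_form})
      \<subseteq> exterior_power (\<Sum>i\<leftarrow>is. ks ! i) V" if "set is \<subseteq> {..<length ks}" for "is"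
    using that
  proof (induction "is")
    case Nil
    then show ?case by (simp add: exterior_power_0)
  next
    case (Cons i js)
    have "exterior_power (ks ! i) (hom_dual (i + 2)) \<subseteq> exterior_power (ks ! i) V"
      using assms[of i] Cons.prems exterior_power_mono exterior_power_0
      by (metis insert_subset lessThan_iff list.simps(15) subset_refl)
    with Cons wedge_space_mono_power show ?case by simp
  qed
  from this[of "[0..<length ks]"] show ?thesis
    by (simp add: type_space_def map_nth atLeast0LessThan[symmetric] interv_sum_list_conv_sum_set_nat)
qed

lemma weight_cochains_subset: "weight_cochains m w \<subseteq> cochains m"
  unfolding weight_cochains_def cochains_eq
proof (intro span_minimal subspace_exterior_power UN_least)
  fix ks assume "ks \<in> {ks. sum_list ks = m \<and> (\<Sum>i<length ks. ks ! i * i) = w}"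
  moreover have "type_space ks \<subseteq> exterior_power (sum_list ks) (\<Union>l\<in>{2..}. hom_dual l)"
    by (rule type_space_subset) (intro disjI2 UN_upper, simp)
  ultimately show "type_space ks \<subseteq> exterior_power m (\<Union>l\<in>{2..}. hom_dual l)" by simp
qed


text \<open>Hence \<open>dim\<close> of a space of cochains of given degree and weight is its true dimension.\<close>

lemma weight_cochains_finite_dim:
  obtains B where "finite B" "weight_cochains m w \<subseteq> span B"
proof -
  define S where "S = (\<lambda>A. one_form (coord A)) ` {A. mdeg A \<le> w + 2}"
  have "finite S" by (simp add: S_def finite_mdeg_le)
  then obtain B where B: "finite B" "exterior_power m S = span B"
    by (rule exterior_power_finite)
  have "type_space ks \<subseteq> span B"
    if ks: "sum_list ks = m" "(\<Sum>i<length ks. ks ! i * i) = w" for ks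
  proof -
    have "ks ! i = 0 \<or> hom_dual (i + 2) \<subseteq> span S" if "i < length ks" for i
    proof -
      have "ks ! i * i \<le> w"
        unfolding ks(2)[symmetric] using that by (intro member_le_sum) auto
      then have "ks ! i = 0 \<or> i \<le> w"
        by (cases "ks ! i") auto
      moreover have "hom_dual (i + 2) \<subseteq> span S" if "i \<le> w"
        using hom_dual_span[of "i + 2"] that unfolding S_def
        by (elim order_trans) (intro span_mono image_mono, auto)
      ultimately show ?thesis by blast
    qed
    then have "type_space ks \<subseteq> exterior_power m (span S)"
      using type_space_subset ks(1) by blast
    then show ?thesis by (simp add: exterior_power_span B(2))
  qed
  then have "weight_cochains m w \<subseteq> span B"
    unfolding weight_cochains_def by (intro span_minimal subspace_span) auto
  with B(1) show ?thesis by (rule that)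
qed


section \<open>The range of the momentum mapping\<close>

lemma sympl_matrix_square: "sympl_matrix ** sympl_matrix = mat (- 1)"
  by (simp add: vec_eq_iff forall_4 matrix_matrix_mult_def sum_4 sympl_matrix_def mat_def)

lemma sympl_matrix_transpose: "transpose sympl_matrix ** sympl_matrix = mat 1"
  by (simp add: vec_eq_iff forall_4 matrix_matrix_mult_def sum_4 sympl_matrix_def mat_def transpose_def)

lemma mdeg_eq_0: "mdeg A = 0 \<Longrightarrow> A = 0"
  by (simp add: mdeg_def vec_eq_iff)

lemma mdeg_SucD:
  assumes "mdeg A = Suc n"
  obtains a B where "A = B + axis a 1" "mdeg B = n"
proof -
  from assms have "\<exists>a. A $ a > 0" by (auto simp: mdeg_def intro: ccontr)
  then obtain a where "A $ a > 0" ..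
  then have "A = (A - axis a 1) + axis a 1"
    using sub_axis_eq_iff by blast
  moreover from this have "mdeg (A - axis a 1) = n"
    using assms mdeg_add[of "A - axis a 1" "axis a 1"] by simp
  ultimately show ?thesis by (rule that)
qed

lemma mdeg_2D:
  assumes "mdeg A = 2"
  obtains a b where "A = axis a 1 + axis b 1"
proof -
  obtain B b where B: "A = B + axis b 1" "mdeg B = Suc 0"
    using mdeg_SucD[of A "Suc 0"] assms by (metis numeral_2_eq_2)
  obtain C a where C: "B = C + axis a 1" "mdeg C = 0"
    using mdeg_SucD[OF B(2)] by metis
  show ?thesis by (rule that[of a b]) (simp add: B(1) C mdeg_eq_0[OF C(2)])
qed

lemma axis_add_eq_iff:
  fixes a b i j :: 4
  shows "axis a (1 :: nat) + axis b 1 = axis i 1 + axis j 1 \<longleftrightarrow> (i, j) \<in> {(a, b), (b, a)}"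
proof
  assume h: "axis a (1 :: nat) + axis b 1 = axis i 1 + axis j 1"
  have *: "(if k = a then 1 else 0) + (if k = b then 1 else 0 :: nat) =
      (if k = i then 1 else 0) + (if k = j then 1 else 0)" for k
    using arg_cong[OF h, of "\<lambda>v. v $ k"]
    by (simp only: vector_add_component axis_def vec_lambda_beta)
  show "(i, j) \<in> {(a, b), (b, a)}"
  proof (cases "i = a")
    case True
    with *[of b] *[of j] show ?thesis by (cases "j = b") simp_all
  next
    case False
    with *[of a] have "j = a" by (cases "j = a") simp_all
    with False *[of i] have "i = b" by (cases "i = b") simp_all
    with \<open>j = a\<close> show ?thesis by simp
  qed
next
  assume "(i, j) \<in> {(a, b), (b, a)}"
  then show "axis a (1 :: nat) + axis b 1 = axis i 1 + axis j 1"
    by (elim insertE emptyE) (simp_all only: prod.inject add.commute[of "axis b 1"])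
qed

lemma coord_momentum:
  "coord A (momentum \<xi>) = (\<Sum>i\<in>UNIV. \<Sum>j\<in>UNIV.
     if A = axis i 1 + axis j 1 then (transpose \<xi> ** sympl_matrix) $ i $ j / 2 else 0)"
  by transfer (simp add: lookup_sum lookup_single when_def eq_commute)

lemma range_momentum: "momentum ` sp4 = {q. homogeneous 2 q}"
proof (intro equalityI subsetI)
  fix q assume "q \<in> momentum ` sp4"
  then show "q \<in> {q. homogeneous 2 q}"
    by (auto simp: homogeneous_iff coord_momentum mdeg_add intro!: sum.neutral)
next
  fix q assume "q \<in> {q. homogeneous 2 q}"
  then have q: "coord A q = 0" if "mdeg A \<noteq> 2" for A
    using that by (simp add: homogeneous_iff)
  define S :: "real ^ 4 ^ 4" where
    "S = (\<chi> i j. (if i = j then 2 else 1) * coord (axis i 1 + axis j 1) q)"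
  define \<xi> where "\<xi> = sympl_matrix ** S"
  have sym: "transpose S = S"
    by (simp add: S_def transpose_def vec_eq_iff add.commute)
  have 1: "transpose \<xi> ** sympl_matrix = S"
    by (simp add: \<xi>_def matrix_transpose_mul sym sympl_matrix_transpose flip: matrix_mul_assoc)
  have "sympl_matrix ** \<xi> = - S"
    unfolding \<xi>_def matrix_mul_assoc sympl_matrix_square
    by (simp add: vec_eq_iff matrix_matrix_mult_def mat_def if_distrib if_distribR sum.delta' cong: if_cong)
  with 1 have "\<xi> \<in> sp4" by (simp add: sp4_def)
  moreover have "q = momentum \<xi>"
  proof (rule ham4_eqI)
    fix A
    show "coord A q = coord A (momentum \<xi>)"
    proof (cases "mdeg A = 2")
      case False
      then have "coord A (momentum \<xi>) = 0"
        by (auto simp: coord_momentum mdeg_add intro!: sum.neutral)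
      with False show ?thesis by (simp add: q)
    next
      case True
      then obtain a b where A: "A = axis a 1 + axis b 1" by (rule mdeg_2D)
      have "coord A (momentum \<xi>) =
          (\<Sum>(i, j)\<in>UNIV. if (i, j) \<in> {(a, b), (b, a)} then S $ i $ j / 2 else 0)"
        unfolding coord_momentum 1 A axis_add_eq_iff
        by (simp only: sum.cartesian_product UNIV_Times_UNIV)
      also have "\<dots> = (\<Sum>(i, j)\<in>{(a, b), (b, a)}. S $ i $ j / 2)"
        by (rule sum.mono_neutral_cong_right) (auto split: if_splits)
      also have "\<dots> = coord A q"
      proof (cases "a = b")
        case True
        then show ?thesis by (simp add: S_def A)
      next
        case False
        moreover have "axis b 1 + axis a 1 = axis a (1 :: nat) + axis b 1" by (rule add.commute)
        ultimately show ?thesis by (simp add: S_def A)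
      qed
      finally show ?thesis ..
    qed
  qed
  ultimately show "q \<in> momentum ` sp4" by blast
qed

end

theory Submission
  imports Defs
begin

text \<open>
  The claim about degree \<open>2\<close> is that the representation of \<open>sp(4)\<close> on cubic polynomials has, up to
  scaling, exactly one invariant skew form; the other degrees carry no relative cochain at all.

  Write \<open>\<sigma>\<close> for a cochain of degree \<open>m\<close> and weight \<open>w\<close>. It is an alternating multilinear form
  which, evaluated on monomials of degrees \<open>l\<^sub>1, \<dots>, l\<^sub>m\<close>, vanishes unless \<open>(l\<^sub>1 - 2) + \<dots> + (l\<^sub>m - 2) = w\<close>
  (\<open>weight_cochains_graded_forms\<close>). By Cartan's formula, being relative means that \<open>\<sigma>\<close> is killed
  by contraction with, and invariant under the Lie derivative along, every quadratic polynomial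
  (\<open>rel_cochains_iff\<close>). A form killed by contraction only sees monomials of degree at least \<open>3\<close>, each
  of which contributes at least \<open>1\<close> to the weight. So it vanishes when \<open>m > w\<close>
  (\<open>horizontal_vanish\<close>), while the weight \<open>w > 0\<close> excludes \<open>m = 0\<close>.

  The two remaining degrees rest on the fact that a space of polynomials which is stable under
  bracketing with quadratics and contains \<open>x\<^sub>1\<^sup>n\<close> contains all monomials of degree \<open>n\<close>
  (\<open>quadratic_cyclic\<close>). In degree \<open>1\<close>, the kernel of an invariant functional is such a space, because
  \<open>{x\<^sub>1 x\<^sub>4, x\<^sub>1\<^sup>n} = - n x\<^sub>1\<^sup>n\<close> (\<open>rel_cochains_1\<close>). In degree \<open>2\<close> and weight \<open>2\<close>,
  invariance under the torus spanned by \<open>x\<^sub>1 x\<^sub>4\<close> and \<open>x\<^sub>2 x\<^sub>3\<close> leaves \<open>x\<^sub>4\<^sup>3\<close> as the only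
  monomial that can pair nontrivially with \<open>x\<^sub>1\<^sup>3\<close>. If that value is zero too, then \<open>x\<^sub>1\<^sup>3\<close>, hence
  every cubic, lies in the radical. A relative cochain is therefore determined by its value
  on \<open>(x\<^sub>1\<^sup>3, x\<^sub>4\<^sup>3)\<close> (\<open>rel_cochains_2_2_eq_0\<close>).

  That a nonzero one exists is the classical apolarity pairing: substitute the derivations
  \<open>{x\<^sub>i, _}\<close> for the variables in one cubic and apply the result to the other. Multiplication by
  \<open>x\<^sub>i\<close> and the derivation \<open>{x\<^sub>i, _}\<close> are adjoint for it up to sign (\<open>pairing_var_left\<close>,
  \<open>pairing_var_right\<close>), which makes every quadratic act by skew-adjoint operators.
\<close>

(* Otherwise the simplifier writes axis i (Suc 0) for axis i 1, and exponent vectors stop matching. *)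
declare One_nat_def [simp del]


section \<open>Alternating multilinear forms with a weight\<close>

definition multilinear :: "'a::real_vector form \<Rightarrow> bool" where
  "multilinear \<sigma> \<longleftrightarrow> (\<forall>fs gs. linear (\<lambda>f. \<sigma> (fs @ f # gs)))"

definition alternating :: "'a form \<Rightarrow> bool" where
  "alternating \<sigma> \<longleftrightarrow> (\<forall>fs f g gs. \<sigma> (fs @ f # g # gs) = - \<sigma> (fs @ g # f # gs))"

lemma multilinearD: "multilinear \<sigma> \<Longrightarrow> linear (\<lambda>f. \<sigma> (fs @ f # gs))"
  by (simp add: multilinear_def)

lemma alternatingD: "alternating \<sigma> \<Longrightarrow> \<sigma> (fs @ f # g # gs) = - \<sigma> (fs @ g # f # gs)"
  unfolding alternating_def by (elim allE)

definition weight :: "(nat ^ 4) list \<Rightarrow> int" where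
  "weight As = (\<Sum>A\<leftarrow>As. int (mdeg A) - 2)"

lemma weight_simps [simp]: "weight [] = 0" "weight (A # As) = int (mdeg A) - 2 + weight As"
  by (simp_all add: weight_def)

text \<open>The weight is an integer because the recursion for \<open>wedge\<close> contracts factors one argument at a
  time, and the weight left over may become negative.\<close>

definition has_weight :: "int \<Rightarrow> ham4 form \<Rightarrow> bool" where
  "has_weight w \<sigma> \<longleftrightarrow> (\<forall>As. \<sigma> (map monomial As) \<noteq> 0 \<longrightarrow> weight As = w)"

lemma has_weightD: "has_weight w \<sigma> \<Longrightarrow> \<sigma> (map monomial As) \<noteq> 0 \<Longrightarrow> weight As = w"
  by (simp add: has_weight_def)

lemma multilinear_interior: "multilinear \<sigma> \<Longrightarrow> multilinear (interior_product h \<sigma>)"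
  unfolding multilinear_def interior_product_def by (simp flip: append_Cons)

lemma alternating_interior:
  assumes "alternating \<sigma>"
  shows "alternating (interior_product h \<sigma>)"
  unfolding alternating_def interior_product_def
proof (intro allI)
  fix fs f g gs
  show "\<sigma> (h # fs @ f # g # gs) = - \<sigma> (h # fs @ g # f # gs)"
    using alternatingD[OF assms, of "h # fs" f g gs] by simp
qed

lemma has_weight_interior:
  assumes "has_weight w \<sigma>"
  shows "has_weight (w - (int (mdeg A) - 2)) (interior_product (monomial A) \<sigma>)"
  unfolding has_weight_def interior_product_def
proof (intro allI impI)
  fix As
  assume "\<sigma> (monomial A # map monomial As) \<noteq> 0"
  with assms have "weight (A # As) = w" by (intro has_weightD) simp_all
  then show "weight As = w - (int (mdeg A) - 2)" by simp
qed

lemma multilinear_sign_inv: "multilinear \<sigma> \<Longrightarrow> multilinear (sign_inv \<sigma>)"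
  unfolding multilinear_def linear_iff sign_inv_def by (simp add: algebra_simps)

lemma alternating_sign_inv:
  assumes "alternating \<sigma>"
  shows "alternating (sign_inv \<sigma>)"
  unfolding alternating_def
proof (intro allI)
  fix fs f g gs
  show "sign_inv \<sigma> (fs @ f # g # gs) = - sign_inv \<sigma> (fs @ g # f # gs)"
    using alternatingD[OF assms, of fs f g gs] by (simp add: sign_inv_def)
qed

lemma has_weight_sign_inv: "has_weight w \<sigma> \<Longrightarrow> has_weight w (sign_inv \<sigma>)"
  by (auto simp: has_weight_def sign_inv_def)

lemma multilinear_interior_add:
  assumes "multilinear \<sigma>"
  shows "interior_product (f + g) \<sigma> = interior_product f \<sigma> + interior_product g \<sigma>"
proof
  fix fs
  have "linear (\<lambda>f. \<sigma> ([] @ f # fs))" using assms unfolding multilinear_def by blast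
  then show "interior_product (f + g) \<sigma> fs = (interior_product f \<sigma> + interior_product g \<sigma>) fs"
    using linear_add by (fastforce simp: interior_product_def)
qed

lemma multilinear_interior_scaleR:
  assumes "multilinear \<sigma>"
  shows "interior_product (c *\<^sub>R f) \<sigma> = c *\<^sub>R interior_product f \<sigma>"
proof
  fix fs
  have "linear (\<lambda>f. \<sigma> ([] @ f # fs))" using assms unfolding multilinear_def by blast
  from linear_scale[OF this] show "interior_product (c *\<^sub>R f) \<sigma> fs = (c *\<^sub>R interior_product f \<sigma>) fs"
    by (simp add: interior_product_def)
qed

lemma linear_interior: "multilinear \<sigma> \<Longrightarrow> linear (\<lambda>f. interior_product f \<sigma>)"
  by (intro linearI multilinear_interior_add multilinear_interior_scaleR)

text \<open>The three closure properties under \<open>wedge\<close> share one induction: contracting with the first argument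
  is an antiderivation (\<open>wedge_Cons\<close>), so an argument list can be consumed from the front while the
  factors change to their contractions, which inherit the property in question.\<close>

lemma multilinear_wedge:
  assumes "multilinear \<alpha>" "multilinear \<beta>"
  shows "multilinear (wedge \<alpha> \<beta>)"
  unfolding multilinear_def
proof (intro allI)
  fix fs gs
  show "linear (\<lambda>f. wedge \<alpha> \<beta> (fs @ f # gs))"
    using assms
  proof (induction fs arbitrary: \<alpha> \<beta>)
    case Nil
    then show ?case
      by (intro linearI) (simp_all add: wedge_Cons multilinear_interior_add
          multilinear_interior_scaleR wedge_add_left wedge_add_right wedge_scaleR_left
          wedge_scaleR_right algebra_simps)
  next
    case (Cons h fs)
    show ?case
      unfolding append_Cons wedge_Cons
      by (intro linear_compose_add Cons.IH multilinear_interior multilinear_sign_inv Cons.prems)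
  qed
qed

text \<open>Alternation at the first two arguments, in the form that drives the case of an empty prefix in
  \<open>alternating_wedge\<close>.\<close>

lemma interior_anticommute:
  assumes "alternating \<sigma>"
  shows "interior_product f (interior_product g \<sigma>) = - interior_product g (interior_product f \<sigma>)"
proof
  fix fs
  have "\<sigma> ([] @ g # f # fs) = - \<sigma> ([] @ f # g # fs)" using assms by (rule alternatingD)
  then show "interior_product f (interior_product g \<sigma>) fs
      = (- interior_product g (interior_product f \<sigma>)) fs"
    by (simp add: interior_product_def)
qed

lemma alternating_wedge:
  assumes "alternating \<alpha>" "alternating \<beta>"
  shows "alternating (wedge \<alpha> \<beta>)"
  unfolding alternating_def
proof (intro allI)
  fix fs f g gs
  show "wedge \<alpha> \<beta> (fs @ f # g # gs) = - wedge \<alpha> \<beta> (fs @ g # f # gs)"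
    using assms
  proof (induction fs arbitrary: \<alpha> \<beta>)
    case Nil
    have s: "interior_product g (sign_inv (sign_inv \<alpha>)) = interior_product g \<alpha>" for g \<alpha>
      by (simp add: fun_eq_iff sign_inv_def interior_product_def flip: power_mult_distrib)
    show ?case
      using interior_anticommute[OF Nil(1), of f g] interior_anticommute[OF Nil(2), of f g]
      by (simp add: wedge_Cons interior_sign_inv wedge_minus_left wedge_minus_right)
  next
    case (Cons h fs)
    then show ?case
      by (simp add: wedge_Cons alternating_interior alternating_sign_inv)
  qed
qed

lemma has_weight_wedge:
  assumes "has_weight v \<alpha>" "has_weight w \<beta>"
  shows "has_weight (v + w) (wedge \<alpha> \<beta>)"
  unfolding has_weight_def
proof (intro allI impI)
  fix As
  assume "wedge \<alpha> \<beta> (map monomial As) \<noteq> 0"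
  with assms show "weight As = v + w"
  proof (induction As arbitrary: \<alpha> \<beta> v w)
    case Nil
    then show ?case using has_weightD[of v \<alpha> "[]"] has_weightD[of w \<beta> "[]"] by (simp add: wedge_Nil)
  next
    case (Cons A As)
    from Cons.prems(3) consider
        "wedge (interior_product (monomial A) \<alpha>) \<beta> (map monomial As) \<noteq> 0"
      | "wedge (sign_inv \<alpha>) (interior_product (monomial A) \<beta>) (map monomial As) \<noteq> 0"
      by (fastforce simp: wedge_Cons)
    then show ?case
    proof cases
      case 1
      from Cons.IH[OF has_weight_interior[OF Cons.prems(1)] Cons.prems(2) 1] show ?thesis by simp
    next
      case 2
      from Cons.IH[OF has_weight_sign_inv[OF Cons.prems(1)] has_weight_interior[OF Cons.prems(2)] 2]
      show ?thesis by simp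
    qed
  qed
qed

definition graded_forms :: "int \<Rightarrow> ham4 form set" where
  "graded_forms w = {\<sigma>. multilinear \<sigma> \<and> alternating \<sigma> \<and> has_weight w \<sigma>}"

lemma subspace_graded_forms: "subspace (graded_forms w)"
  unfolding subspace_def
proof (intro conjI ballI allI)
  show "0 \<in> graded_forms w"
    by (auto simp: graded_forms_def multilinear_def alternating_def has_weight_def linear_zero)
next
  fix \<alpha> \<beta> assume a: "\<alpha> \<in> graded_forms w" "\<beta> \<in> graded_forms w"
  have "alternating (\<alpha> + \<beta>)"
    unfolding alternating_def
  proof (intro allI)
    fix fs f g gs
    have "\<gamma> (fs @ f # g # gs) = - \<gamma> (fs @ g # f # gs)" if "\<gamma> \<in> graded_forms w" for \<gamma>
      using that by (simp add: graded_forms_def alternatingD[of \<gamma> fs f g gs])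
    from this[OF a(1)] this[OF a(2)]
    show "(\<alpha> + \<beta>) (fs @ f # g # gs) = - (\<alpha> + \<beta>) (fs @ g # f # gs)" by simp
  qed
  moreover have "has_weight w (\<alpha> + \<beta>)"
    unfolding has_weight_def
  proof (intro allI impI)
    fix As assume "(\<alpha> + \<beta>) (map monomial As) \<noteq> 0"
    then have "\<alpha> (map monomial As) \<noteq> 0 \<or> \<beta> (map monomial As) \<noteq> 0" by auto
    with a show "weight As = w" by (auto simp: graded_forms_def has_weight_def)
  qed
  ultimately show "\<alpha> + \<beta> \<in> graded_forms w"
    using a by (simp add: graded_forms_def multilinear_def linear_compose_add)
next
  fix c \<alpha> assume a: "\<alpha> \<in> graded_forms w"
  have "alternating (c *\<^sub>R \<alpha>)"
    unfolding alternating_def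
  proof (intro allI)
    fix fs f g gs
    have "\<alpha> (fs @ f # g # gs) = - \<alpha> (fs @ g # f # gs)"
      using a by (simp add: graded_forms_def alternatingD[of \<alpha> fs f g gs])
    then show "(c *\<^sub>R \<alpha>) (fs @ f # g # gs) = - (c *\<^sub>R \<alpha>) (fs @ g # f # gs)" by simp
  qed
  then show "c *\<^sub>R \<alpha> \<in> graded_forms w"
    using a by (simp add: graded_forms_def multilinear_def linear_iff has_weight_def algebra_simps)
qed

lemma graded_forms_wedge:
  "\<alpha> \<in> graded_forms v \<Longrightarrow> \<beta> \<in> graded_forms w \<Longrightarrow> wedge \<alpha> \<beta> \<in> graded_forms (v + w)"
  by (simp add: graded_forms_def multilinear_wedge alternating_wedge has_weight_wedge)

lemma unit_graded_form: "unit_form \<in> graded_forms 0"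
  by (auto simp: graded_forms_def multilinear_def alternating_def has_weight_def unit_form_def
      linear_zero)

lemma hom_dual_graded_forms: "hom_dual l \<subseteq> graded_forms (int l - 2)"
proof
  fix \<zeta> assume "\<zeta> \<in> hom_dual l"
  then obtain z where z: "\<zeta> = one_form z" "linear z"
      "\<And>k f. homogeneous k f \<Longrightarrow> k \<noteq> l \<Longrightarrow> z f = 0"
    unfolding hom_dual_def mem_Collect_eq by metis
  have "linear (\<lambda>f. one_form z (fs @ f # gs))" for fs gs
  proof (cases "fs = [] \<and> gs = []")
    case True
    then show ?thesis using z(2) by (simp add: one_form_def)
  next
    case False
    then have "(\<lambda>f. one_form z (fs @ f # gs)) = (\<lambda>f. 0)"
      by (auto simp: one_form_def fun_eq_iff append_eq_Cons_conv split: list.split)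
    then show ?thesis by (simp add: linear_zero)
  qed
  moreover have "alternating (one_form z)"
    by (auto simp: alternating_def one_form_def Cons_eq_append_conv append_eq_Cons_conv split: list.split)
  moreover have "weight As = int l - 2" if nz: "one_form z (map monomial As) \<noteq> 0" for As
  proof -
    obtain A where "As = [A]" "z (monomial A) \<noteq> 0"
      using nz by (cases As rule: remdups_adj.cases) (simp_all add: one_form_def)
    then show ?thesis using z(3)[OF homogeneous_monomial] by force
  qed
  ultimately show "\<zeta> \<in> graded_forms (int l - 2)"
    by (simp add: z(1) graded_forms_def multilinear_def has_weight_def)
qed

lemma exterior_power_graded_forms:
  assumes "V \<subseteq> graded_forms w"
  shows "exterior_power n V \<subseteq> graded_forms (int n * w)"
proof -
  have "foldr wedge zs unit_form \<in> graded_forms (int (length zs) * w)" if "set zs \<subseteq> V" for zs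
    using that
  proof (induction zs)
    case (Cons z zs)
    then show ?case
      using graded_forms_wedge[of z w _ "int (length zs) * w"] assms by (auto simp: algebra_simps)
  qed (simp add: unit_graded_form)
  then show ?thesis
    unfolding exterior_power_def by (intro span_minimal subspace_graded_forms) auto
qed

lemma type_space_graded_forms:
  "type_space ks \<subseteq> graded_forms (\<Sum>i<length ks. int (ks ! i) * int i)"
proof -
  have "foldr wedge_space (map (\<lambda>i. exterior_power (ks ! i) (hom_dual (i + 2))) is) (span {unit_form})
      \<subseteq> graded_forms (\<Sum>i\<leftarrow>is. int (ks ! i) * int i)" for "is"
  proof (induction "is")
    case Nil
    show ?case by (simp add: span_minimal subspace_graded_forms unit_graded_form)
  next
    case (Cons i js)
    have "exterior_power (ks ! i) (hom_dual (i + 2)) \<subseteq> graded_forms (int (ks ! i) * int i)"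
      using exterior_power_graded_forms[OF hom_dual_graded_forms, of "ks ! i" "i + 2"] by simp
    with Cons show ?case
      unfolding list.map foldr.simps comp_apply wedge_space_def[of "exterior_power _ _"]
      by (intro span_minimal subspace_graded_forms) (auto intro!: graded_forms_wedge)
  qed
  from this[of "[0..<length ks]"] show ?thesis
    by (simp add: type_space_def atLeast0LessThan[symmetric] interv_sum_list_conv_sum_set_nat)
qed

lemma weight_cochains_graded_forms: "weight_cochains m w \<subseteq> graded_forms (int w)"
  unfolding weight_cochains_def
proof (intro span_minimal subspace_graded_forms UN_least)
  fix ks assume "ks \<in> {ks. sum_list ks = m \<and> (\<Sum>i<length ks. ks ! i * i) = w}"
  then have "(\<Sum>i<length ks. int (ks ! i) * int i) = int w" by (auto simp flip: of_nat_mult of_nat_sum)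
  then show "type_space ks \<subseteq> graded_forms (int w)" using type_space_graded_forms[of ks] by simp
qed

text \<open>Every polynomial is a finite combination of monomials, so the arguments can be expanded one by one.\<close>

lemma multilinear_eq_0:
  assumes "multilinear \<sigma>" "\<And>As. \<sigma> (map monomial As) = 0"
  shows "\<sigma> = 0"
proof
  fix fs show "\<sigma> fs = 0 fs"
    using assms
  proof (induction fs arbitrary: \<sigma>)
    case Nil
    from Nil(2)[of "[]"] show ?case by simp
  next
    case (Cons f fs)
    have 0: "interior_product (monomial A) \<sigma> fs = 0" for A
    proof -
      have "interior_product (monomial A) \<sigma> (map monomial As) = 0" for As
        using Cons.prems(2)[of "A # As"] by (simp add: interior_product_def)
      with Cons.IH[OF multilinear_interior[OF Cons.prems(1)]] show ?thesis by simp
    qed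
    note lin = linear_interior[OF Cons.prems(1)]
    have "\<sigma> (f # fs) = interior_product f \<sigma> fs" by (simp add: interior_product_def)
    also have "\<dots> = interior_product (\<Sum>A\<in>support f. coord A f *\<^sub>R monomial A) \<sigma> fs"
      using ham4_expand[OF finite_support[of f] order_refl] by (rule arg_cong)
    also have "\<dots> = 0"
      by (simp add: linear_sum[OF lin] linear_scale[OF lin] 0)
    finally show ?case by simp
  qed
qed


section \<open>Forms killed by contraction with quadratic polynomials\<close>

definition horizontal :: "ham4 form \<Rightarrow> bool" where
  "horizontal \<sigma> \<longleftrightarrow> (\<forall>q. homogeneous 2 q \<longrightarrow> interior_product q \<sigma> = 0)"

text \<open>Contraction only concerns the first argument; adjacent swaps carry \<open>q\<close> there.\<close>

lemma horizontal_eq_0: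
  assumes "horizontal \<sigma>" "alternating \<sigma>" "homogeneous 2 q"
  shows "\<sigma> (fs @ q # gs) = 0"
proof (induction fs arbitrary: gs rule: rev_induct)
  case Nil
  have "interior_product q \<sigma> gs = 0" using assms by (simp add: horizontal_def)
  then show ?case by (simp add: interior_product_def)
next
  case (snoc h fs)
  have "\<sigma> (fs @ h # q # gs) = - \<sigma> (fs @ q # h # gs)"
    using assms(2) by (rule alternatingD)
  then show ?case using snoc by simp
qed

lemma horizontal_monomial:
  assumes "horizontal \<sigma>" "multilinear \<sigma>" "alternating \<sigma>" "mdeg A \<le> 2"
  shows "\<sigma> (fs @ monomial A # gs) = 0"
proof (cases "mdeg A = 2")
  case True
  with homogeneous_monomial[of A] show ?thesis by (intro horizontal_eq_0 assms) simp
next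
  case False
  with assms(4) have "monomial A = 0" by transfer auto
  moreover have "linear (\<lambda>f. \<sigma> (fs @ f # gs))" using assms(2) by (simp add: multilinear_def)
  ultimately show ?thesis using linear_0 by simp
qed

lemma length_le_weight: "(\<And>A. A \<in> set As \<Longrightarrow> 3 \<le> mdeg A) \<Longrightarrow> int (length As) \<le> weight As"
  by (induction As) fastforce+

text \<open>All arguments that matter have degree at least \<open>3\<close>, and then \<open>m\<close> of them have weight at least
  \<open>m > w\<close>.\<close>

lemma horizontal_vanish:
  assumes \<sigma>: "\<sigma> \<in> weight_cochains m w" and hor: "horizontal \<sigma>" and "w < m"
  shows "\<sigma> = 0"
proof (rule multilinear_eq_0)
  have g: "multilinear \<sigma>" "alternating \<sigma>" "has_weight (int w) \<sigma>"
    using \<sigma> weight_cochains_graded_forms by (auto simp: graded_forms_def)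
  have deg: "\<sigma> \<in> degree_forms m"
    using \<sigma> weight_cochains_subset cochains_degree by blast
  show "multilinear \<sigma>" by fact
  fix As
  show "\<sigma> (map monomial As) = 0"
  proof (cases "\<exists>A\<in>set As. mdeg A \<le> 2")
    case True
    then obtain A Bs Cs where A: "mdeg A \<le> 2" "As = Bs @ A # Cs"
      by (metis split_list)
    with hor g(1,2) show ?thesis by (simp add: horizontal_monomial)
  next
    case False
    then have "int (length As) \<le> weight As" by (intro length_le_weight) force
    with \<open>w < m\<close> have "weight As \<noteq> int w \<or> length As \<noteq> m" by linarith
    then show ?thesis using g(3) deg by (auto simp: has_weight_def degree_forms_def)
  qed
qed

lemma weight_cochains_degree_0: "weight_cochains 0 w = {0}" if "0 < w"
proof (intro equalityI subsetI)
  fix \<sigma> assume \<sigma>: "\<sigma> \<in> weight_cochains 0 w"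
  then have "multilinear \<sigma>" "has_weight (int w) \<sigma>" "\<sigma> \<in> degree_forms 0"
    using weight_cochains_graded_forms[of 0 w] weight_cochains_subset[of 0 w] cochains_degree[of 0]
    by (auto simp: graded_forms_def)
  then have "\<sigma> (map monomial As) = 0" for As
    using that has_weightD[of "int w" \<sigma> As] by (cases "As = []") (auto simp: degree_forms_def)
  with \<open>multilinear \<sigma>\<close> show "\<sigma> \<in> {0}" by (simp add: multilinear_eq_0)
qed (simp add: weight_cochains_def span_zero)


section \<open>Relative cochains as horizontal invariant forms\<close>

lemma coboundary_eq_ce: "\<sigma> \<in> weight_cochains m w \<Longrightarrow> coboundary \<sigma> = ce \<sigma>"
  using is_coboundary_unique[OF is_coboundary_coboundary is_coboundary_ce] weight_cochains_subset
  by blast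

text \<open>Cartan's formula turns the condition \<open>i\<^sub>q (d \<sigma>) = 0\<close> into invariance under \<open>q\<close>, once
  \<open>i\<^sub>q \<sigma> = 0\<close>.\<close>

lemma rel_cochains_iff:
  "\<sigma> \<in> rel_cochains m w \<longleftrightarrow>
     \<sigma> \<in> weight_cochains m w \<and> horizontal \<sigma> \<and> (\<forall>q. homogeneous 2 q \<longrightarrow> lie q \<sigma> = 0)"
proof -
  have "\<sigma> \<in> rel_cochains m w \<longleftrightarrow> \<sigma> \<in> weight_cochains m w \<and> (\<forall>q\<in>{q. homogeneous 2 q}.
      interior_product q \<sigma> = 0 \<and> interior_product q (coboundary \<sigma>) = 0)"
    unfolding range_momentum[symmetric] by (simp add: rel_cochains_def)
  then show ?thesis
    by (auto simp: horizontal_def coboundary_eq_ce interior_ce ce_zero)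
qed

lemma subspace_rel_cochains: "subspace (rel_cochains m w)"
proof -
  have lin: "linear coboundary"
    using is_coboundary_coboundary by (simp add: is_coboundary_def)
  have "subspace (weight_cochains m w)" by (simp add: weight_cochains_def)
  then show ?thesis
    unfolding subspace_def rel_cochains_def
    by (auto simp: linear_add[OF lin] linear_scale[OF lin] linear_0[OF lin] interior_add interior_scaleR)
      (simp_all add: interior_product_def fun_eq_iff)
qed

lemma weight_cochainsD:
  assumes "\<sigma> \<in> weight_cochains m w"
  shows "multilinear \<sigma>" "alternating \<sigma>" "has_weight (int w) \<sigma>" "\<sigma> \<in> degree_forms m"
  using assms weight_cochains_graded_forms[of m w] weight_cochains_subset[of m w] cochains_degree[of m]
  by (auto simp: graded_forms_def)

lemma lie_1: "lie q \<sigma> [f] = - \<sigma> [bracket q f]"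
  by (simp add: interior_product_def)

lemma lie_2: "lie q \<sigma> [f, g] = - \<sigma> [bracket q f, g] - \<sigma> [f, bracket q g]"
  by (simp add: interior_product_def)


section \<open>Brackets with quadratic polynomials\<close>

text \<open>In the index type \<open>4 = 0\<close>, so that \<open>1 - i\<close> is the index \<open>5 - i\<close> of the variable conjugate to
  \<open>x\<^sub>i\<close>: the pairs are \<open>(x\<^sub>1, x\<^sub>4)\<close> and \<open>(x\<^sub>2, x\<^sub>3)\<close>.\<close>

definition conj_index :: "4 \<Rightarrow> 4" where
  "conj_index i = 1 - i"

definition conj_sign :: "4 \<Rightarrow> real" where
  "conj_sign i = (if i = 1 \<or> i = 2 then 1 else - 1)"

lemma conj_index_involution [simp]: "conj_index (conj_index i) = i"
  by (simp add: conj_index_def)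

lemma conj_index_simps [simp]:
  "conj_index 1 = 4" "conj_index 2 = 3" "conj_index 3 = 2" "conj_index 4 = 1"
  by (simp_all add: conj_index_def)

lemma conj_sign_simps [simp]:
  "conj_sign 1 = 1" "conj_sign 2 = 1" "conj_sign 3 = - 1" "conj_sign 4 = - 1"
  by (simp_all add: conj_sign_def)

lemma conj_sign_conj_index: "conj_sign (conj_index i) = - conj_sign i"
  using exhaust_4[of i] by auto

abbreviation var :: "4 \<Rightarrow> poly4" where
  "var i \<equiv> Poly_Mapping.single (axis i 1) 1"

text \<open>The derivation \<open>{x\<^sub>i, _}\<close>. It is defined apart from the bracket of \<open>ham4\<close>, which excludes
  linear potentials.\<close>

definition ham_deriv :: "4 \<Rightarrow> poly4 \<Rightarrow> poly4" where
  "ham_deriv i g = conj_sign i *\<^sub>R partial (conj_index i) g"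

lemma partial_single:
  "partial i (Poly_Mapping.single A c) = Poly_Mapping.single (A - axis i 1) (real (A $ i) * c)"
  by (cases "c = 0") (simp_all add: partial_def)

lemma partial_quadratic:
  "partial k (Poly_Mapping.single (axis i 1 + axis j 1) 1) =
     (if k = i then var j else 0) + (if k = j then var i else 0)"
  by (auto simp: partial_single axis_def single_add[symmetric] vec_eq_iff intro!: arg_cong2[where f = Poly_Mapping.single])

text \<open>The Leibniz rule for \<open>{x\<^sub>i x\<^sub>j, g}\<close>. It reduces all statements about quadratic Hamiltonians to
  multiplication by a variable and \<open>ham_deriv\<close>.\<close>

lemma poisson_quadratic:
  "poisson (Poly_Mapping.single (axis i 1 + axis j 1) 1) g = var i * ham_deriv j g + var j * ham_deriv i g"
  using exhaust_4[of i] exhaust_4[of j]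
  by (elim disjE) (simp_all add: poisson_def partial_quadratic ham_deriv_def algebra_simps)

text \<open>Subtraction of exponents truncates, but only where the coefficient \<open>A $ k\<close> is zero. Where it
  is nonzero, the shifted exponent has the degree of \<open>A\<close>, so \<open>monomial\<close> does not take the default
  value \<open>0\<close> that it has on exponents of degree below \<open>2\<close>.\<close>

lemma Rep_scaleR_monomial:
  assumes "2 \<le> mdeg A"
  shows "Rep_ham4 ((c * real (A $ k)) *\<^sub>R monomial (A - axis k 1 + axis i 1)) =
    Poly_Mapping.single (A - axis k 1 + axis i 1) (c * real (A $ k))"
proof (cases "A $ k = 0")
  case False
  then have "A = (A - axis k 1) + axis k 1" using sub_axis_eq_iff by blast
  then have "mdeg A = mdeg (A - axis k 1 + axis i 1)" by (metis mdeg_add mdeg_axis)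
  with assms show ?thesis
    by (simp add: scaleR_ham4.rep_eq monomial.rep_eq scaleR_conv_times mult_single)
qed (simp add: zero_ham4.rep_eq)

lemma var_times_ham_deriv_single:
  "var i * ham_deriv j (Poly_Mapping.single A 1) =
     Poly_Mapping.single (A - axis (conj_index j) 1 + axis i 1) (conj_sign j * real (A $ conj_index j))"
  by (simp add: ham_deriv_def partial_single scaleR_conv_times mult_single add.commute)

lemma bracket_quadratic_monomial:
  assumes "2 \<le> mdeg A"
  shows "bracket (monomial (axis i 1 + axis j 1)) (monomial A) =
    (conj_sign j * real (A $ conj_index j)) *\<^sub>R monomial (A - axis (conj_index j) 1 + axis i 1)
    + (conj_sign i * real (A $ conj_index i)) *\<^sub>R monomial (A - axis (conj_index i) 1 + axis j 1)"
    (is "?l = ?r")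
proof -
  have "Rep_ham4 ?l = poisson (Poly_Mapping.single (axis i 1 + axis j 1) 1) (Poly_Mapping.single A 1)"
    using assms by (simp add: bracket.rep_eq monomial.rep_eq mdeg_add)
  also have "\<dots> = Rep_ham4 ?r"
    unfolding poisson_quadratic var_times_ham_deriv_single plus_ham4.rep_eq
      Rep_scaleR_monomial[OF assms] ..
  finally show ?thesis by (simp only: Rep_ham4_inject)
qed

lemma homogeneous_quadratic_monomial: "homogeneous 2 (monomial (axis i 1 + axis j 1))"
  using homogeneous_monomial[of "axis i 1 + axis j 1"] by (simp add: mdeg_add)

lemma mdeg_eq: "mdeg A = A $ 1 + A $ 2 + A $ 3 + A $ 4"
  by (simp add: mdeg_def sum_4)

text \<open>The polynomials \<open>x\<^sub>1 x\<^sub>4\<close> and \<open>x\<^sub>2 x\<^sub>3\<close> span a Cartan subalgebra, with the monomials as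
  simultaneous eigenvectors.\<close>

lemma bracket_torus:
  assumes "2 \<le> mdeg A"
  shows "bracket (monomial (axis i 1 + axis (conj_index i) 1)) (monomial A) =
    (conj_sign i * (real (A $ conj_index i) - real (A $ i))) *\<^sub>R monomial A"
proof -
  have cancel: "(c * real (A $ k)) *\<^sub>R monomial (A - axis k 1 + axis k 1) = (c * real (A $ k)) *\<^sub>R monomial A"
    for c k
    using sub_axis_eq_iff[of A k "A - axis k 1"] by (cases "A $ k = 0") auto
  show ?thesis
    unfolding bracket_quadratic_monomial[OF assms] conj_index_involution cancel
    by (simp add: conj_sign_conj_index scaleR_left_distrib[symmetric] algebra_simps)
qed

text \<open>The operators \<open>x\<^sub>3 \<partial>\<^sub>2\<close>, \<open>x\<^sub>4 \<partial>\<^sub>1\<close> and, on polynomials free of \<open>x\<^sub>3\<close>, \<open>x\<^sub>2 \<partial>\<^sub>1\<close> are brackets with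
  quadratics up to a factor. A power of \<open>x\<^sub>1\<close> turns into any monomial of its degree by applying
  \<open>x\<^sub>2 \<partial>\<^sub>1\<close> first, then \<open>x\<^sub>4 \<partial>\<^sub>1\<close>, then \<open>x\<^sub>3 \<partial>\<^sub>2\<close>, each sufficiently often.\<close>

lemma quadratic_cyclic:
  assumes R: "subspace R"
    and stable: "\<And>q f. homogeneous 2 q \<Longrightarrow> f \<in> R \<Longrightarrow> bracket q f \<in> R"
    and start: "monomial (axis 1 (mdeg A)) \<in> R" and deg: "2 \<le> mdeg A"
  shows "monomial A \<in> R"
proof -
  have unscale: "f \<in> R" if "c *\<^sub>R f \<in> R" "c \<noteq> 0" for c :: real and f
    using subspace_scale[OF R that(1), of "inverse c"] that(2) by simp
  have "monomial B \<in> R" if "mdeg B = mdeg A" for B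
    using that
  proof (induction "2 * B $ 3 + B $ 2 + B $ 4" arbitrary: B rule: less_induct)
    case less
    have IH: "monomial (B - axis i 1 + axis k 1) \<in> R"
      if "B $ i > 0" "(i, k) \<in> {(3, 2), (4, 1), (2, 1)}" for i k
    proof (rule less.hyps)
      let ?C = "B - axis i 1 + axis k 1"
      show "2 * ?C $ 3 + ?C $ 2 + ?C $ 4 < 2 * B $ 3 + B $ 2 + B $ 4"
        using that by (auto simp: axis_def)
      have "B = (B - axis i 1) + axis i 1" using that(1) sub_axis_eq_iff by blast
      then show "mdeg ?C = mdeg A" using less.prems by (metis mdeg_add mdeg_axis)
    qed
    have br: "bracket (monomial (axis i 1 + axis j 1)) (monomial (B - axis l 1 + axis k 1)) \<in> R"
      if "B $ l > 0" "(l, k) \<in> {(3, 2), (4, 1), (2, 1)}" for i j k l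
      using IH[OF that] by (intro stable homogeneous_quadratic_monomial)
    have undo: "B - axis i 1 + axis k 1 - axis k 1 + axis i 1 = B" if "B $ i > 0" for i k
      using that by (auto simp: vec_eq_iff axis_def)
    have degC: "2 \<le> mdeg (B - axis i 1 + axis k 1)" if "B $ i > 0" for i k
    proof -
      have "B = (B - axis i 1) + axis i 1" using that sub_axis_eq_iff by blast
      then show ?thesis using less.prems deg by (metis mdeg_add mdeg_axis)
    qed
    (* Undo the last operator: x3 d2, x4 d1 and x2 d1 are half of -{x3^2, _}, half of -{x4^2, _}
       and, in the absence of x3, -{x2 x4, _}. *)
    consider "B $ 3 > 0" | "B $ 4 > 0" | "B $ 3 = 0" "B $ 4 = 0" "B $ 2 > 0" | "B $ 2 = 0" "B $ 3 = 0" "B $ 4 = 0"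
      by blast
    then show ?case
    proof cases
      case 1
      have "(- 2 * real (B $ 2 + 1)) *\<^sub>R monomial B \<in> R"
        using br[of 3 2 3 3] 1 undo[OF 1, of 2] unfolding bracket_quadratic_monomial[OF degC[OF 1]]
        by (simp add: axis_def scaleR_left_distrib[symmetric])
      then show ?thesis by (rule unscale) simp
    next
      case 2
      have "(- 2 * real (B $ 1 + 1)) *\<^sub>R monomial B \<in> R"
        using br[of 4 1 4 4] 2 undo[OF 2, of 1] unfolding bracket_quadratic_monomial[OF degC[OF 2]]
        by (simp add: axis_def scaleR_left_distrib[symmetric])
      then show ?thesis by (rule unscale) simp
    next
      case 3
      have "(- real (B $ 1 + 1)) *\<^sub>R monomial B \<in> R"
        using br[of 2 1 2 4] 3 undo[OF 3(3), of 1] unfolding bracket_quadratic_monomial[OF degC[OF 3(3)]]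
        by (simp add: axis_def)
      then show ?thesis by (rule unscale) simp
    next
      case 4
      then have "B = axis 1 (mdeg A)"
        using less.prems by (simp add: vec_eq_iff forall_4 mdeg_eq axis_def)
      with start show ?thesis by simp
    qed
  qed
  then show ?thesis by simp
qed


section \<open>Relative cochains of degrees one and two\<close>

text \<open>The kernel of an invariant functional contains every bracket \<open>{q, f}\<close> with \<open>q\<close> quadratic. In
  particular it contains \<open>x\<^sub>1\<^sup>n\<close>, an eigenvector of \<open>x\<^sub>1 x\<^sub>4\<close> with eigenvalue \<open>- n\<close>, and then
  every monomial by \<open>quadratic_cyclic\<close>.\<close>

lemma rel_cochains_1: "rel_cochains 1 w = {0}"
proof (intro equalityI subsetI)
  fix \<sigma> assume "\<sigma> \<in> rel_cochains 1 w"
  then have inv: "\<And>q. homogeneous 2 q \<Longrightarrow> lie q \<sigma> = 0"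
    and hor: "horizontal \<sigma>" and wt: "\<sigma> \<in> weight_cochains 1 w"
    by (auto simp: rel_cochains_iff)
  note \<sigma> = weight_cochainsD[OF wt]
  have br: "\<sigma> [bracket q f] = 0" if "homogeneous 2 q" for q f
    using inv[OF that] lie_1[of q \<sigma> f] by simp
  have lin: "linear (\<lambda>f. \<sigma> [f])"
    using multilinearD[OF \<sigma>(1), of "[]"] by simp
  have mon: "\<sigma> [monomial A] = 0" for A
  proof (cases "2 \<le> mdeg A")
    case True
    have "monomial A \<in> {f. \<sigma> [f] = 0}"
    proof (rule quadratic_cyclic[OF _ _ _ True])
      show "subspace {f. \<sigma> [f] = 0}" by (rule linear_subspace_kernel[OF lin])
      show "bracket q f \<in> {f. \<sigma> [f] = 0}" if "homogeneous 2 q" for q f using br[OF that] by simp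
      let ?B = "axis 1 (mdeg A) :: nat ^ 4"
      have "\<sigma> [(- real (mdeg A)) *\<^sub>R monomial ?B] = 0"
        using br[OF homogeneous_quadratic_monomial, of 1 "conj_index 1" "monomial ?B"] True
        unfolding bracket_torus[of ?B 1, simplified mdeg_axis, OF True] by (simp add: axis_def)
      then show "monomial ?B \<in> {f. \<sigma> [f] = 0}"
        using True by (simp add: linear_scale[OF lin] linear_neg[OF lin])
    qed
    then show ?thesis by simp
  next
    case False
    then show ?thesis using horizontal_monomial[OF hor \<sigma>(1,2), of A "[]" "[]"] by simp
  qed
  have "\<sigma> (map monomial As) = 0" for As
    using mon \<sigma>(4) by (cases As rule: remdups_adj.cases) (auto simp: degree_forms_def)
  with \<sigma>(1) show "\<sigma> \<in> {0}" by (simp add: multilinear_eq_0)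
qed (simp add: subspace_0[OF subspace_rel_cochains])

text \<open>The radical of an invariant form is stable under quadratics, so it suffices to place \<open>x\<^sub>1\<^sup>3\<close> in it.
  Once all cubics lie there, the form is zero: for weight \<open>2\<close> the degrees of two monomials add up to
  \<open>6\<close>, so they are both cubic or one of them has degree at most \<open>2\<close>.\<close>

lemma rel_cochains_2_2_eq_0:
  assumes rel: "\<sigma> \<in> rel_cochains 2 2"
    and top: "\<sigma> [monomial (axis 1 3), monomial (axis 4 3)] = 0"
  shows "\<sigma> = 0"
proof -
  from rel have inv: "\<And>q. homogeneous 2 q \<Longrightarrow> lie q \<sigma> = 0"
    and hor: "horizontal \<sigma>" and wt: "\<sigma> \<in> weight_cochains 2 2"
    by (auto simp: rel_cochains_iff)
  note \<sigma> = weight_cochainsD[OF wt]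
  have inv2: "\<sigma> [bracket q f, g] = - \<sigma> [f, bracket q g]" if "homogeneous 2 q" for q f g
    using inv[OF that] lie_2[of q \<sigma> f g] by simp
  have lin1: "linear (\<lambda>f. \<sigma> [f, g])" for g
    using multilinearD[OF \<sigma>(1), of "[]"] by simp
  have lin2: "linear (\<lambda>g. \<sigma> [f, g])" for f
    using multilinearD[OF \<sigma>(1), of "[f]" "[]"] by simp
  have sum6: "mdeg A + mdeg B = 6" if "\<sigma> [monomial A, monomial B] \<noteq> 0" for A B
    using has_weightD[OF \<sigma>(3), of "[A, B]"] that by simp
  let ?X = "monomial (axis 1 3)"
  have X: "\<sigma> [?X, monomial B] = 0" for B
  proof (rule ccontr)
    assume nz: "\<sigma> [?X, monomial B] \<noteq> 0"
    with sum6 have B: "mdeg B = 3" by fastforce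
    (* The torus weights of the two arguments must cancel. *)
    have t: "B $ conj_index i + axis 1 3 $ conj_index i = B $ i + axis (1::4) 3 $ i" for i
    proof -
      let ?q = "monomial (axis i 1 + axis (conj_index i) 1)"
      let ?x = "conj_sign i * (real (axis 1 3 $ conj_index i) - real (axis (1::4) 3 $ i))"
      let ?y = "conj_sign i * (real (B $ conj_index i) - real (B $ i))"
      have X: "bracket ?q ?X = ?x *\<^sub>R ?X" by (rule bracket_torus) simp
      have Y: "bracket ?q (monomial B) = ?y *\<^sub>R monomial B" by (rule bracket_torus) (simp add: B)
      have "?x * \<sigma> [?X, monomial B] = - (?y * \<sigma> [?X, monomial B])"
        using inv2[OF homogeneous_quadratic_monomial, of i "conj_index i" ?X "monomial B"]
        unfolding X Y linear_scale[OF lin1] linear_scale[OF lin2] real_scaleR_def .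
      then have "(?x + ?y) * \<sigma> [?X, monomial B] = 0" by (simp only: distrib_right add_eq_0_iff2)
      with nz have "?x + ?y = 0" by simp
      then show ?thesis by (auto simp: conj_sign_def split: if_splits)
    qed
    have "B = axis 4 3"
      using t[of 1] t[of 2] B by (simp add: vec_eq_iff forall_4 mdeg_eq axis_def)
    with nz top show False by simp
  qed
  have "interior_product ?X \<sigma> = 0"
  proof (rule multilinear_eq_0[OF multilinear_interior[OF \<sigma>(1)]])
    fix As show "interior_product ?X \<sigma> (map monomial As) = 0"
      using X \<sigma>(4) by (cases As rule: remdups_adj.cases) (auto simp: degree_forms_def interior_product_def)
  qed
  then have X0: "\<sigma> [?X, g] = 0" for g using fun_cong[of _ _ "[g]"] by (fastforce simp: interior_product_def)
  define R where "R = {f. \<forall>g. \<sigma> [f, g] = 0}"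
  have cubic: "monomial A \<in> R" if "mdeg A = 3" for A
  proof (rule quadratic_cyclic)
    show "subspace R"
      by (simp add: subspace_def R_def linear_0[OF lin1] linear_add[OF lin1] linear_scale[OF lin1])
    show "bracket q f \<in> R" if "homogeneous 2 q" "f \<in> R" for q f
      using that inv2 by (simp add: R_def)
    show "monomial (axis 1 (mdeg A)) \<in> R" using X0 by (simp add: R_def that)
  qed (simp add: that)
  have "\<sigma> [monomial A, monomial B] = 0" for A B
  proof (rule ccontr)
    assume nz: "\<sigma> [monomial A, monomial B] \<noteq> 0"
    consider "mdeg A = 3" | "mdeg A \<le> 2" | "mdeg B \<le> 2" using sum6[OF nz] by linarith
    then show False
    proof cases
      case 1
      with cubic nz show False by (auto simp: R_def)
    next
      case 2
      with horizontal_monomial[OF hor \<sigma>(1,2), of A "[]" "[monomial B]"] nz show False by simp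
    next
      case 3
      with horizontal_monomial[OF hor \<sigma>(1,2), of B "[monomial A]" "[]"] nz show False by simp
    qed
  qed
  then have "\<sigma> (map monomial As) = 0" if "length As = 2" for As
    using that by (auto simp: numeral_2_eq_2 length_Suc_conv)
  then have "\<sigma> (map monomial As) = 0" for As
    using \<sigma>(4) by (cases "length As = 2") (auto simp: degree_forms_def)
  with \<sigma>(1) show ?thesis by (rule multilinear_eq_0)
qed


section \<open>The invariant pairing of polynomials\<close>

lemma lookup_single_times:
  "Poly_Mapping.lookup (Poly_Mapping.single B 1 * (p :: poly4)) A =
     (\<Sum>C. Poly_Mapping.lookup p C when A = B + C)"
proof -
  have "Poly_Mapping.lookup (Poly_Mapping.single B 1 * p) A =
      (\<Sum>D. (\<Sum>C. Poly_Mapping.lookup p C when A = D + C) when D = B)"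
    unfolding lookup_mult
    by (intro arg_cong[of _ _ Sum_any] ext) (simp add: lookup_single when_def)
  then show ?thesis by simp
qed

lemma lookup_var_times:
  "Poly_Mapping.lookup (var i * p) (A + axis i 1) = Poly_Mapping.lookup p A"
proof -
  have "A + axis i 1 = axis i 1 + C \<longleftrightarrow> C = A" for C
    by (metis add.commute add_left_cancel)
  then show ?thesis unfolding lookup_single_times by simp
qed

lemma lookup_var_times_0:
  assumes "A $ i = 0"
  shows "Poly_Mapping.lookup (var i * p) A = 0"
proof -
  have "A \<noteq> axis i 1 + C" for C using assms by (auto simp: axis_def)
  then show ?thesis unfolding lookup_single_times by simp
qed

definition conj_exp :: "nat ^ 4 \<Rightarrow> nat ^ 4" where
  "conj_exp A = (\<chi> i. A $ conj_index i)"

lemma conj_exp_nth [simp]: "conj_exp A $ i = A $ conj_index i"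
  by (simp add: conj_exp_def)

lemma conj_exp_add: "conj_exp (A + B) = conj_exp A + conj_exp B"
  by (simp add: vec_eq_iff)

lemma conj_exp_axis [simp]: "conj_exp (axis i c) = axis (conj_index i) c"
  by (auto simp: vec_eq_iff axis_def)

lemma mdeg_conj_exp [simp]: "mdeg (conj_exp A) = mdeg A"
  by (simp add: mdeg_eq)

text \<open>The value of the pairing of \<open>x\<^sup>A\<close> with \<open>x\<close> to the power \<open>conj_exp A\<close>, forced by adjointness: this
  constant is what remains after applying \<open>{x\<^sub>i, _}\<close> to the second monomial \<open>A $ i\<close> times for
  each \<open>i\<close>. The sign is the parity of the number of factors \<open>x\<^sub>3\<close> and \<open>x\<^sub>4\<close>, for which
  \<open>{x\<^sub>3, _} = - \<partial>\<^sub>2\<close> and \<open>{x\<^sub>4, _} = - \<partial>\<^sub>1\<close>.\<close>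

definition pairing_coeff :: "nat ^ 4 \<Rightarrow> real" where
  "pairing_coeff A = (- 1) ^ (A $ 3 + A $ 4) * (\<Prod>i\<in>UNIV. fact (A $ i))"

lemma pairing_coeff_add_axis:
  "pairing_coeff (A + axis i 1) = conj_sign i * real (A $ i + 1) * pairing_coeff A"
proof -
  have p: "(\<Prod>k\<in>UNIV. f k) = f 1 * f 2 * f 3 * f (4::4)" for f :: "4 \<Rightarrow> real"
    unfolding UNIV_4 by simp
  show ?thesis
    using exhaust_4[of i] by (elim disjE) (simp_all add: pairing_coeff_def p axis_def algebra_simps One_nat_def)
qed

definition pairing :: "nat \<Rightarrow> poly4 \<Rightarrow> poly4 \<Rightarrow> real" where
  "pairing n f g = (\<Sum>A | mdeg A = n.
     pairing_coeff A * Poly_Mapping.lookup f A * Poly_Mapping.lookup g (conj_exp A))"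

lemma finite_mdeg_eq: "finite {A. mdeg A = n}"
  by (rule finite_subset[OF _ finite_mdeg_le[of n]]) auto

text \<open>The index shift behind the adjunctions: only monomials divisible by \<open>x\<^sub>i\<close> contribute.\<close>

lemma sum_mdeg_Suc:
  assumes "\<And>A. mdeg A = Suc n \<Longrightarrow> A $ i = 0 \<Longrightarrow> F A = 0"
  shows "(\<Sum>A | mdeg A = Suc n. F A) = (\<Sum>A | mdeg A = n. F (A + axis i 1) :: real)"
proof -
  have "(\<Sum>A | mdeg A = n. F (A + axis i 1)) = sum F ((\<lambda>A. A + axis i 1) ` {A. mdeg A = n})"
    by (subst sum.reindex) (auto simp: inj_on_def)
  also have "\<dots> = (\<Sum>A | mdeg A = Suc n. F A)"
  proof (rule sum.mono_neutral_left[OF finite_mdeg_eq])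
    show "(\<lambda>A. A + axis i 1) ` {A. mdeg A = n} \<subseteq> {A. mdeg A = Suc n}"
      by (auto simp: mdeg_add)
    show "\<forall>A\<in>{A. mdeg A = Suc n} - (\<lambda>A. A + axis i 1) ` {A. mdeg A = n}. F A = 0"
    proof (intro ballI assms)
      fix A assume A: "A \<in> {A. mdeg A = Suc n} - (\<lambda>A. A + axis i 1) ` {A. mdeg A = n}"
      then show "mdeg A = Suc n" by simp
      show "A $ i = 0"
      proof (rule ccontr)
        assume "A $ i \<noteq> 0"
        then have B: "A = (A - axis i 1) + axis i 1" using sub_axis_eq_iff by blast
        then have "mdeg A = mdeg (A - axis i 1) + 1" by (metis mdeg_add mdeg_axis)
        with A B show False by auto
      qed
    qed
  qed
  finally show ?thesis ..
qed

lemma lookup_ham_deriv: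
  "Poly_Mapping.lookup (ham_deriv i g) A =
     conj_sign i * (real (A $ conj_index i + 1) * Poly_Mapping.lookup g (A + axis (conj_index i) 1))"
  by (simp only: ham_deriv_def lookup_scaleR' lookup_partial)

text \<open>The two adjunctions differ in sign because conjugate indices carry opposite signs.\<close>

lemma pairing_var_left:
  "pairing (Suc n) (var i * f) g = pairing n f (ham_deriv i g)"
  unfolding pairing_def
proof (subst sum_mdeg_Suc[where i = i])
  show "(\<Sum>A | mdeg A = n. pairing_coeff (A + axis i 1) * Poly_Mapping.lookup (var i * f) (A + axis i 1) *
            Poly_Mapping.lookup g (conj_exp (A + axis i 1))) =
    (\<Sum>A | mdeg A = n. pairing_coeff A * Poly_Mapping.lookup f A *
            Poly_Mapping.lookup (ham_deriv i g) (conj_exp A))"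
    unfolding lookup_var_times pairing_coeff_add_axis conj_exp_add conj_exp_axis lookup_ham_deriv
    by (simp add: mult_ac)
qed (simp add: lookup_var_times_0)

lemma pairing_var_right:
  "pairing (Suc n) f (var i * g) = - pairing n (ham_deriv i f) g"
  unfolding pairing_def
proof (subst sum_mdeg_Suc[where i = "conj_index i"])
  have "conj_sign i * conj_sign i = 1" by (simp add: conj_sign_def)
  then show "(\<Sum>A | mdeg A = n. pairing_coeff (A + axis (conj_index i) 1) *
            Poly_Mapping.lookup f (A + axis (conj_index i) 1) *
            Poly_Mapping.lookup (var i * g) (conj_exp (A + axis (conj_index i) 1))) =
    - (\<Sum>A | mdeg A = n. pairing_coeff A * Poly_Mapping.lookup (ham_deriv i f) A *
            Poly_Mapping.lookup g (conj_exp A))"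
    unfolding conj_exp_add conj_exp_axis conj_index_involution lookup_var_times
      pairing_coeff_add_axis lookup_ham_deriv conj_sign_conj_index sum_negf[symmetric]
    by (simp add: mult_ac)
qed (simp add: lookup_var_times_0)

lemma pairing_add_left: "pairing n (f + f') g = pairing n f g + pairing n f' g"
  by (simp add: pairing_def lookup_add algebra_simps sum.distrib)

lemma pairing_add_right: "pairing n f (g + g') = pairing n f g + pairing n f g'"
  by (simp add: pairing_def lookup_add algebra_simps sum.distrib)

text \<open>Moving the variables of \<open>x\<^sub>i D\<^sub>j + x\<^sub>j D\<^sub>i\<close>, with \<open>D\<^sub>i = {x\<^sub>i, _}\<close>, to the other side turns the
  first summand into \<open>\<langle>D\<^sub>i f, D\<^sub>j g\<rangle> + \<langle>D\<^sub>j f, D\<^sub>i g\<rangle>\<close> and the second into its negative.\<close>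

lemma pairing_invariant_quadratic:
  fixes i j :: 4
  defines "q \<equiv> Poly_Mapping.single (axis i 1 + axis j 1) 1"
  shows "pairing (Suc n) (poisson q f) g + pairing (Suc n) f (poisson q g) = 0"
  unfolding q_def poisson_quadratic pairing_add_left pairing_add_right pairing_var_left pairing_var_right
  by simp

text \<open>Antisymmetrising makes this a cochain for every \<open>n\<close>. For odd \<open>n\<close> the pairing is itself skew, so
  nothing cancels.\<close>

definition pairing_form :: "nat \<Rightarrow> ham4 form" where
  "pairing_form n = (\<Sum>A | mdeg A = n.
     pairing_coeff A *\<^sub>R wedge (one_form (coord A)) (one_form (coord (conj_exp A))))"

lemma pairing_form_eq:
  "pairing_form n [f, g] =
     pairing n (Rep_ham4 f) (Rep_ham4 g) - pairing n (Rep_ham4 g) (Rep_ham4 f)"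
  by (simp add: pairing_form_def pairing_def wedge_one_forms coord.rep_eq sum_subtractf
      right_diff_distrib mult.assoc)

text \<open>The exponent list \<open>[0, 2]\<close> is the type \<open>\<Lambda>\<^sup>2 S\<^sub>3\<close>.\<close>

lemma pairing_form_cochain: "pairing_form 3 \<in> weight_cochains 2 2"
proof -
  have "wedge (one_form (coord A)) (one_form (coord (conj_exp A))) \<in> type_space [0, 2]"
    if "mdeg A = 3" for A
  proof -
    let ?\<omega> = "wedge (one_form (coord A)) (one_form (coord (conj_exp A)))"
    have "one_form (coord A) \<in> hom_dual 3" "one_form (coord (conj_exp A)) \<in> hom_dual 3"
      using coord_in_hom_dual[of A] coord_in_hom_dual[of "conj_exp A"] that by simp_all
    then have "?\<omega> \<in> exterior_power 2 (hom_dual 3)"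
      using exterior_power_Suc[OF _ in_exterior_power_1] by (metis Suc_1)
    then have "wedge unit_form (wedge ?\<omega> unit_form) \<in>
        wedge_space (exterior_power 0 (hom_dual 2))
          (wedge_space (exterior_power 2 (hom_dual 3)) (span {unit_form}))"
      unfolding wedge_space_def
      by (intro span_base CollectI exI[of _ unit_form] exI[of _ "wedge ?\<omega> unit_form"]
          exI[of _ ?\<omega>] conjI refl unit_in_exterior_power singletonI)
    then show ?thesis by (simp add: type_space_def upt_rec eval_nat_numeral One_nat_def)
  qed
  moreover have "[0, 2] \<in> {ks. sum_list ks = 2 \<and> (\<Sum>i<length ks. ks ! i * i) = 2}"
    by (simp add: lessThan_Suc)
  ultimately show ?thesis
    unfolding pairing_form_def weight_cochains_def
    by (intro span_sum span_scale span_base) blast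
qed

lemma pairing_bracket_linear:
  "linear (\<lambda>q. pairing n (Rep_ham4 (bracket q f)) (Rep_ham4 g) + pairing n (Rep_ham4 f) (Rep_ham4 (bracket q g)))"
proof -
  have "linear (\<lambda>f. pairing n (Rep_ham4 f) h)" "linear (\<lambda>g. pairing n h (Rep_ham4 g))" for h
    by (auto intro!: linearI simp: plus_ham4.rep_eq pairing_add_left pairing_add_right)
      (simp_all add: pairing_def scaleR_ham4.rep_eq lookup_scaleR' sum_distrib_left mult_ac)
  then show ?thesis
    by (intro linear_compose_add linear_compose[OF bracket_linear_left, unfolded comp_def])
qed

lemma pairing_invariant:
  assumes "homogeneous 2 q"
  shows "pairing (Suc n) (Rep_ham4 (bracket q f)) (Rep_ham4 g)
    + pairing (Suc n) (Rep_ham4 f) (Rep_ham4 (bracket q g)) = 0" (is "?L q = 0")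
proof -
  have mon: "?L (monomial A) = 0" if A: "mdeg A = 2" for A
  proof -
    obtain i j where "A = axis i 1 + axis j 1" using mdeg_2D[OF A] .
    then have "Rep_ham4 (monomial A) = Poly_Mapping.single (axis i 1 + axis j 1) 1"
      using A by (simp add: monomial.rep_eq)
    then show ?thesis by (simp only: bracket.rep_eq pairing_invariant_quadratic)
  qed
  have "q = (\<Sum>A | mdeg A = 2. coord A q *\<^sub>R monomial A)"
    using assms by (intro ham4_expand finite_mdeg_eq) (auto simp: support_eq homogeneous_iff)
  then have "?L q = ?L (\<Sum>A | mdeg A = 2. coord A q *\<^sub>R monomial A)" by (rule arg_cong)
  also have "\<dots> = (\<Sum>A | mdeg A = 2. coord A q *\<^sub>R ?L (monomial A))"
    by (simp only: linear_sum[OF pairing_bracket_linear] linear_scale[OF pairing_bracket_linear])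
  also have "\<dots> = 0" by (intro sum.neutral) (simp add: mon)
  finally show ?thesis .
qed

lemma pairing_form_relative: "pairing_form 3 \<in> rel_cochains 2 2"
  unfolding rel_cochains_iff
proof (intro conjI allI impI)
  let ?\<omega> = "pairing_form 3"
  show wt: "?\<omega> \<in> weight_cochains 2 2" by (rule pairing_form_cochain)
  have deg: "?\<omega> \<in> degree_forms 2" by (rule weight_cochainsD[OF wt])
  show hor: "horizontal ?\<omega>"
    unfolding horizontal_def
  proof (intro allI impI ext)
    fix q fs assume q: "homogeneous 2 q"
    show "interior_product q ?\<omega> fs = 0 fs"
    proof (cases fs rule: remdups_adj.cases)
      case (2 g)
      have "Poly_Mapping.lookup (Rep_ham4 q) A = 0" if "mdeg A = 3" for A
        using q that by (simp add: homogeneous_iff coord.rep_eq)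
      then show ?thesis by (simp add: 2 interior_product_def pairing_form_eq pairing_def)
    qed (use deg in \<open>simp_all add: interior_product_def degree_forms_def\<close>)
  qed
  fix q assume q: "homogeneous 2 q"
  (* The Lie derivative preserves the degree because ce raises it by one and contraction lowers it. *)
  have lie_ce: "lie q ?\<omega> = interior_product q (ce ?\<omega>)"
    using hor q by (simp add: interior_ce horizontal_def ce_zero)
  have "ce ?\<omega> \<in> degree_forms (2 + 1)"
    using ce_cochains wt weight_cochains_subset cochains_degree by blast
  then have lie_deg: "lie q ?\<omega> fs = 0" if "length fs \<noteq> 2" for fs
    unfolding lie_ce interior_product_def degree_forms_def using that by (simp del: ce_Cons)
  have "lie q ?\<omega> [f, g] = 0" for f g
    using pairing_invariant[OF q, of 2 f g] pairing_invariant[OF q, of 2 g f]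
    unfolding lie_2 pairing_form_eq by simp
  then have "lie q ?\<omega> fs = 0" if "length fs = 2" for fs
    using that by (auto simp: numeral_2_eq_2 length_Suc_conv)
  with lie_deg show "lie q ?\<omega> = 0" by (metis ext zero_fun_apply)
qed

lemma pairing_single:
  "pairing n (Poly_Mapping.single A 1) (Poly_Mapping.single (conj_exp A) 1) =
     (if mdeg A = n then pairing_coeff A else 0)"
proof -
  have "pairing n (Poly_Mapping.single A 1) (Poly_Mapping.single (conj_exp A) 1) =
      (\<Sum>B | mdeg B = n. if B = A then pairing_coeff A else 0)"
    unfolding pairing_def by (intro sum.cong refl) (auto simp: lookup_single when_def)
  then show ?thesis by (simp add: finite_mdeg_eq)
qed

lemma pairing_form_nonzero: "pairing_form 3 [monomial (axis 1 3), monomial (axis 4 3)] \<noteq> 0"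
proof -
  have c: "pairing_coeff (axis 1 3) = 6" "pairing_coeff (axis 4 3) = - 6"
    unfolding pairing_coeff_def UNIV_4 by (simp_all add: axis_def fact_numeral)
  show ?thesis
    using pairing_single[of 3 "axis 1 3"] pairing_single[of 3 "axis 4 3"]
    by (simp add: pairing_form_eq monomial.rep_eq c)
qed


section \<open>Dimensions and Euler characteristic\<close>

lemma rel_cochains_2_2: "rel_cochains 2 2 = span {pairing_form 3}"
proof (intro equalityI subsetI)
  fix \<sigma> assume \<sigma>: "\<sigma> \<in> rel_cochains 2 2"
  define c where "c = \<sigma> [monomial (axis 1 3), monomial (axis 4 3)]
    / pairing_form 3 [monomial (axis 1 3), monomial (axis 4 3)]"
  have "\<sigma> - c *\<^sub>R pairing_form 3 = 0"
  proof (rule rel_cochains_2_2_eq_0)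
    show "\<sigma> - c *\<^sub>R pairing_form 3 \<in> rel_cochains 2 2"
      by (intro subspace_diff subspace_scale subspace_rel_cochains \<sigma> pairing_form_relative)
  qed (simp add: c_def pairing_form_nonzero)
  then show "\<sigma> \<in> span {pairing_form 3}" by (auto simp: span_singleton)
next
  fix \<sigma> assume "\<sigma> \<in> span {pairing_form 3}"
  then show "\<sigma> \<in> rel_cochains 2 2"
    using pairing_form_relative span_minimal[OF _ subspace_rel_cochains, of "{pairing_form 3}"] by blast
qed

theorem proposition3:
  shows "dim (rel_cochains 0 2) = 0 \<and> dim (rel_cochains 1 2) = 0 \<and> dim (rel_cochains 2 2) = 1 \<and>
    euler_number 2 = 1"
proof -
  have "pairing_form 3 \<noteq> 0" using pairing_form_nonzero by auto
  then have 2: "dim (rel_cochains 2 2) = 1"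
    by (simp add: rel_cochains_2_2 dim_eq_card_independent)
  have other: "rel_cochains m 2 = {0}" if m: "m \<noteq> 2" for m
  proof -
    have "rel_cochains m 2 \<subseteq> {0}"
    proof -
      consider "m = 0" | "m = 1" | "2 < m" using m by linarith
      then show ?thesis
      proof cases
        case 1
        then have "rel_cochains m 2 \<subseteq> weight_cochains 0 2" unfolding rel_cochains_def by blast
        then show ?thesis by (simp add: weight_cochains_degree_0)
      next
        case 2
        then show ?thesis by (simp add: rel_cochains_1)
      next
        case 3
        have "\<sigma> = 0" if "\<sigma> \<in> rel_cochains m 2" for \<sigma>
          using that 3 horizontal_vanish[of \<sigma> m 2] by (simp only: rel_cochains_iff)
        then show ?thesis by blast
      qed
    qed
    with subspace_0[OF subspace_rel_cochains] show ?thesis by blast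
  qed
  have "dim (span {} :: ham4 form set) = 0"
    by (simp only: dim_span_eq_card_independent[OF independent_empty] card.empty)
  then have dim_other: "dim (rel_cochains m 2) = 0" if "m \<noteq> 2" for m
    using other[OF that] by (simp only: span_empty)
  have "euler_number 2 = (\<Sum>m\<in>{2}. (- 1) ^ m * int (dim (rel_cochains m 2)))"
    unfolding euler_number_def
  proof (rule Sum_any.expand_superset)
    show "{m. (- 1) ^ m * int (dim (rel_cochains m 2)) \<noteq> 0} \<subseteq> {2}"
      using dim_other by fastforce
  qed simp
  then show ?thesis using 2 dim_other by simp
qed

end
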